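(* Let $\Omega\subset\mathbb{R}^n$ be open and bounded, $\mu$ a finite positive Borel measure on $\Omega$, and $a\in L^1(\Omega,\mu)$ with $a>0$ $\mu$-a.e. Let $A,B$ be closed separable subalgebras of $BC(\mathbb{B}^d)$ containing $C(\overline{\mathbb{B}^d})$. Let $(v_j)_j\subset L^1(\Omega,\mu,\mathbb{R}^d)$ be a norm-bounded sequence such that $$v_j\xrightarrow{Y(\mu,A)}(\nu_x,\lambda_\nu,\nu_x^\infty)\quad\text{and}\quad\frac{v_j}{a}\xrightarrow{Y(a\,d\mu,B)}(\eta_x,\lambda_\eta,\eta_x^\infty).$$ Then $\eta_x=\big(\tfrac{\cdot}{a(x)}\big)_\#\nu_x$ for $\mu$-a.e. $x$, and $\lambda_\nu=\lambda_\eta=:\lambda$. Moreover, if $\tilde\nu_x^\infty$ and $\tilde\eta_x^\infty$ denote the projections (push-forwards) of $\nu_x^\infty$ and $\eta_x^\infty$ onto the sphere $\partial\mathbb{B}^d$, then $\tilde\nu_x^\infty=\tilde\eta_x^\infty$ for $\lambda$-a.e. $x$, and $$v_j\xrightarrow{Y(\mu,\mathbb{B}^d)}(\nu_x,\lambda,\tilde\nu_x^\infty).$$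
   Context: $\mathbb{B}^d$ is the open unit ball of $\mathbb{R}^d$, $BC$ denotes bounded continuous real functions with sup norm, and functions in $C(\overline{\mathbb{B}^d})$ are regarded as elements of $BC(\mathbb{B}^d)$ by restriction. For a closed separable subalgebra $A\subset BC(\mathbb{B}^d)$ containing $C(\overline{\mathbb{B}^d})$, let $K_A=e_A\mathbb{B}^d$ be the closure of the image of $\mathbb{B}^d$ under $z\mapsto(g(z))_{g\in A}\in\prod_{g\in A}[\inf g,\sup g]$ (product topology); this is a compactification of $\mathbb{B}^d$, and $\partial K_A=K_A\setminus\mathbb{B}^d$. Since $C(\overline{\mathbb{B}^d})\subset A$ there is a canonical continuous surjection $K_A\to\overline{\mathbb{B}^d}$ which is the identity on $\mathbb{B}^d$ and maps $\partial K_A$ onto $\partial\mathbb{B}^d$; projections onto the sphere are push-forwards under this map. For $f\in C(\mathbb{R}^d)$ put $Tf(\hat z)=(1-|\hat z|)f\big(\frac{\hat z}{1-|\hat z|}\big)$, $\hat z\in\mathbb{B}^d$. If $Tf$ extends continuously to $K_A$, let $f^\infty$ be the restriction of the extension to $\partial K_A$. For a finite positive measure $\mu$ on $\Omega$, a sequence $v_j$ bounded in $L^1(\Omega,\mu,\mathbb{R}^d)$ satisfies $v_j\xrightarrow{Y(\mu,A)}(\nu_x,\lambda,\nu_x^\infty)$, where $(\nu_x)_{x\in\Omega}$ is a $\mu$-measurable family of probability measures on $\mathbb{R}^d$ with $\int_\Omega\int|z|d\nu_xd\mu<\infty$, $\lambda$ is a finite positive Borel measure on $\overline\Omega$, and $(\nu_x^\infty)_{x\in\overline\Omega}$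 is a $\lambda$-measurable family of probability measures on $\partial K_A$, if for all $\phi\in C(\overline\Omega)$ and all $f\in C(\mathbb{R}^d)$ such that $Tf$ extends continuously to $K_A$ $$\int_\Omega\phi f(v_j)d\mu\to\int_\Omega\phi\int f\,d\nu_x\,d\mu+\int_{\overline\Omega}\phi\int_{\partial K_A}f^\infty d\nu_x^\infty\,d\lambda.$$ $Y(\mu,\mathbb{B}^d)$ denotes the case $A=C(\overline{\mathbb{B}^d})$, $K_A=\overline{\mathbb{B}^d}$ (sphere compactification). $(\tfrac{\cdot}{a(x)})_\#\nu_x$ is the push-forward of $\nu_x$ under $z\mapsto z/a(x)$. *)

theory Defs
  imports "HOL-Probability.Probability"
begin

section \<open>Compactifications of the unit ball\<close>

text \<open>The space of bounded continuous real functions on the open unit ball with its sup metric.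
  Its elements are extensional, that is, undefined outside the ball.\<close>

definition BC_ball :: "('d::euclidean_space \<Rightarrow> real) metric" where
  "BC_ball = cfunspace (top_of_set (ball 0 1)) euclidean_metric"

definition C_cball :: "('d::euclidean_space \<Rightarrow> real) set" where
  "C_cball = {restrict g (ball 0 1) |g. continuous_on (cball 0 1) g}"

definition closed_separable_subalgebra :: "('d::euclidean_space \<Rightarrow> real) set \<Rightarrow> bool" where
  "closed_separable_subalgebra A \<longleftrightarrow>
     closedin (mtopology_of BC_ball) A \<and>
     separable_space (subtopology (mtopology_of BC_ball) A) \<and>
     A \<noteq> {} \<and>
     (\<forall>f\<in>A. \<forall>g\<in>A. (\<lambda>z\<in>ball 0 1. f z + g z) \<in> A) \<and>
     (\<forall>c. \<forall>f\<in>A. (\<lambda>z\<in>ball 0 1. c * f z) \<in> A) \<and>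
     (\<forall>f\<in>A. \<forall>g\<in>A. (\<lambda>z\<in>ball 0 1. f z * g z) \<in> A)"

definition eval_emb :: "('d::euclidean_space \<Rightarrow> real) set \<Rightarrow> 'd \<Rightarrow> (('d \<Rightarrow> real) \<Rightarrow> real)" where
  "eval_emb A z = (\<lambda>g\<in>A. g z)"

definition cube_top :: "('d::euclidean_space \<Rightarrow> real) set \<Rightarrow> (('d \<Rightarrow> real) \<Rightarrow> real) topology" where
  "cube_top A = product_topology
     (\<lambda>g. top_of_set {(INF z\<in>ball 0 1. g z)..(SUP z\<in>ball 0 1. g z)}) A"

definition K_top :: "('d::euclidean_space \<Rightarrow> real) set \<Rightarrow> (('d \<Rightarrow> real) \<Rightarrow> real) topology" where
  "K_top A = subtopology (cube_top A) (cube_top A closure_of (eval_emb A ` ball 0 1))"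

text \<open>A compactification of the ball is given by a topology \<open>X\<close> and an embedding \<open>e\<close> of the ball.
  The sphere compactification is the closed ball with the inclusion;
  lemma \<open>sphere_compactification\<close> below identifies it with \<open>K_top C_cball\<close>.\<close>

definition bdry :: "'k topology \<Rightarrow> ('d::euclidean_space \<Rightarrow> 'k) \<Rightarrow> 'k set" where
  "bdry X e = topspace X - e ` ball 0 1"

definition borel_of :: "'k topology \<Rightarrow> 'k measure" where
  "borel_of X = sigma (topspace X) {U. openin X U}"

definition bdry_borel :: "'k topology \<Rightarrow> ('d::euclidean_space \<Rightarrow> 'k) \<Rightarrow> 'k measure" where
  "bdry_borel X e = borel_of (subtopology X (bdry X e))"

definition K_proj :: "('d::euclidean_space \<Rightarrow> real) set \<Rightarrow> (('d \<Rightarrow> real) \<Rightarrow> real) \<Rightarrow> 'd" where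
  "K_proj A = (THE p. p \<in> extensional (topspace (K_top A)) \<and>
     continuous_map (K_top A) (top_of_set (cball 0 1)) p \<and>
     (\<forall>z\<in>ball 0 1. p (eval_emb A z) = z))"

definition sphere_proj ::
  "('d::euclidean_space \<Rightarrow> real) set \<Rightarrow> (('d \<Rightarrow> real) \<Rightarrow> real) measure \<Rightarrow> 'd measure" where
  "sphere_proj A \<kappa> = distr \<kappa> (restrict_space borel (sphere 0 1)) (K_proj A)"


section \<open>Generalized Young measures\<close>

definition T_trans :: "('d::euclidean_space \<Rightarrow> real) \<Rightarrow> 'd \<Rightarrow> real" where
  "T_trans f z = (1 - norm z) * f (z /\<^sub>R (1 - norm z))"

text \<open>\<open>F\<close> is the continuous extension of \<open>T_trans f\<close> to the compactification. Its values on
  \<open>bdry X e\<close>, which are determined by \<open>f\<close>, are the recession function of \<open>f\<close>.\<close>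

definition T_extension ::
  "'k topology \<Rightarrow> ('d::euclidean_space \<Rightarrow> 'k) \<Rightarrow> ('d \<Rightarrow> real) \<Rightarrow> ('k \<Rightarrow> real) \<Rightarrow> bool" where
  "T_extension X e f F \<longleftrightarrow>
     continuous_map X euclideanreal F \<and> (\<forall>z\<in>ball 0 1. F (e z) = T_trans f z)"

definition L1_bounded :: "'n measure \<Rightarrow> (nat \<Rightarrow> 'n \<Rightarrow> 'd::euclidean_space) \<Rightarrow> bool" where
  "L1_bounded M v \<longleftrightarrow> (\<forall>j. integrable M (v j)) \<and> (\<exists>C. \<forall>j. (\<integral>x. norm (v j x) \<partial>M) \<le> C)"

text \<open>Measurability of the families \<open>\<nu>\<close> and \<open>\<nu>i\<close> with respect to \<open>M\<close> and \<open>lam\<close> is measurability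
  for the completed measures, so the outer integrals are taken over the completions as well.\<close>

definition young_conv ::
  "'n::euclidean_space set \<Rightarrow> 'k topology \<Rightarrow> ('d::euclidean_space \<Rightarrow> 'k) \<Rightarrow> 'n measure \<Rightarrow>
   (nat \<Rightarrow> 'n \<Rightarrow> 'd) \<Rightarrow> ('n \<Rightarrow> 'd measure) \<Rightarrow> 'n measure \<Rightarrow> ('n \<Rightarrow> 'k measure) \<Rightarrow> bool" where
  "young_conv \<Omega> X e M v \<nu> lam \<nu>i \<longleftrightarrow>
     L1_bounded M v \<and>
     \<nu> \<in> completion M \<rightarrow>\<^sub>M prob_algebra borel \<and>
     (\<integral>\<^sup>+x. (\<integral>\<^sup>+z. ennreal (norm z) \<partial>\<nu> x) \<partial>completion M) < \<infinity> \<and>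
     finite_measure lam \<and> sets lam = sets (restrict_space borel (closure \<Omega>)) \<and>
     \<nu>i \<in> completion lam \<rightarrow>\<^sub>M prob_algebra (bdry_borel X e) \<and>
     (\<forall>\<phi> f F. continuous_on (closure \<Omega>) \<phi> \<longrightarrow> continuous_on UNIV f \<longrightarrow> T_extension X e f F \<longrightarrow>
        (\<lambda>j. \<integral>x. \<phi> x * f (v j x) \<partial>M) \<longlonglongrightarrow>
          (\<integral>x. \<phi> x * (\<integral>z. f z \<partial>\<nu> x) \<partial>completion M) +
          (\<integral>x. \<phi> x * (\<integral>\<xi>. F \<xi> \<partial>\<nu>i x) \<partial>completion lam))"

abbreviation young_conv_alg where
  "young_conv_alg \<Omega> M A \<equiv> young_conv \<Omega> (K_top A) (eval_emb A) M"

abbreviation young_conv_sphere where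
  "young_conv_sphere \<Omega> M \<equiv> young_conv \<Omega> (top_of_set (cball 0 1)) (\<lambda>z. z) M"


section \<open>Well-definedness of the projection and of the sphere compactification\<close>

lemma eval_emb_in_cube:
  assumes "A \<subseteq> mspace BC_ball" "z \<in> ball 0 1"
  shows "eval_emb A z \<in> topspace (cube_top A)"
proof -
  have "g z \<in> {(INF z\<in>ball 0 1. g z)..(SUP z\<in>ball 0 1. g z)}" if "g \<in> A" for g
  proof -
    have "Met_TC.mbounded (g ` ball 0 1)"
      using that assms(1) by (auto simp: BC_ball_def Met_TC.fspace_def)
    then have "bounded (g ` ball 0 1)" by simp
    then have "bdd_below (g ` ball 0 1)" "bdd_above (g ` ball 0 1)"
      by (auto intro: bounded_imp_bdd_below bounded_imp_bdd_above)
    then show ?thesis using assms(2) by (auto intro: cINF_lower cSUP_upper)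
  qed
  then show ?thesis by (auto simp: cube_top_def eval_emb_def)
qed

lemma topspace_K_top: "topspace (K_top A) = cube_top A closure_of (eval_emb A ` ball 0 1)"
  using closure_of_subset_topspace[of "cube_top A"] by (auto simp: K_top_def)

lemma compact_K_top: "compact_space (K_top A)"
proof -
  have "compact_space (cube_top A)"
    by (auto simp: cube_top_def compact_space_product_topology compact_space_subtopology)
  then show ?thesis
    unfolding K_top_def
    by (simp add: closedin_compact_space compact_space_subtopology)
qed

lemma dense_K_top:
  assumes "A \<subseteq> mspace BC_ball"
  shows "eval_emb A ` ball 0 1 \<subseteq> topspace (K_top A)"
    "K_top A closure_of (eval_emb A ` ball 0 1) = topspace (K_top A)"
proof -
  have s: "eval_emb A ` ball 0 1 \<subseteq> topspace (cube_top A)"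
    using eval_emb_in_cube[OF assms] by blast
  then show "eval_emb A ` ball 0 1 \<subseteq> topspace (K_top A)"
    by (simp add: topspace_K_top closure_of_subset)
  have "eval_emb A ` ball 0 1 \<subseteq> cube_top A closure_of (eval_emb A ` ball 0 1)"
    using s by (rule closure_of_subset)
  then have "(cube_top A closure_of (eval_emb A ` ball 0 1)) \<inter> eval_emb A ` ball 0 1 = eval_emb A ` ball 0 1"
    by blast
  then show "K_top A closure_of (eval_emb A ` ball 0 1) = topspace (K_top A)"
    unfolding topspace_K_top by (simp only: K_top_def closure_of_subtopology Int_absorb)
qed

lemma continuous_map_K_eval:
  assumes "g \<in> A"
  shows "continuous_map (K_top A) euclideanreal (\<lambda>\<xi>. \<xi> g)"
proof -
  have "continuous_map (cube_top A) (top_of_set {(INF z\<in>ball 0 1. g z)..(SUP z\<in>ball 0 1. g z)}) (\<lambda>\<xi>. \<xi> g)"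
    unfolding cube_top_def by (rule continuous_map_product_projection[OF assms])
  then show ?thesis
    unfolding K_top_def
    by (intro continuous_map_from_subtopology) (simp add: continuous_map_in_subtopology)
qed

lemma K_proj_ex1:
  fixes A :: "('d::euclidean_space \<Rightarrow> real) set"
  assumes "A \<subseteq> mspace BC_ball" "C_cball \<subseteq> A"
  shows "\<exists>!p. p \<in> extensional (topspace (K_top A)) \<and>
     continuous_map (K_top A) (top_of_set (cball 0 1)) p \<and>
     (\<forall>z\<in>ball 0 1. p (eval_emb A z) = z)"
proof -
  define c where "c b = restrict (\<lambda>z::'d. z \<bullet> b) (ball 0 1)" for b
  have c: "c b \<in> A" for b
    using assms(2) by (auto simp: c_def C_cball_def intro!: continuous_intros)
  define q where "q = (\<lambda>\<xi>\<in>topspace (K_top A). \<Sum>b\<in>Basis. \<xi> (c b) *\<^sub>R b)"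
  have "continuous_map (K_top A) euclidean (\<lambda>\<xi>. \<xi> (c b) *\<^sub>R b)" for b
  proof -
    have "continuous_map euclideanreal euclidean (\<lambda>r. r *\<^sub>R b)"
      by (auto intro: continuous_intros)
    from continuous_map_compose[OF continuous_map_K_eval[OF c] this] show ?thesis
      by (simp add: o_def)
  qed
  then have "continuous_map (K_top A) euclidean (\<lambda>\<xi>. \<Sum>b\<in>Basis. \<xi> (c b) *\<^sub>R b)"
    by (intro continuous_map_sum) auto
  then have cq: "continuous_map (K_top A) euclidean q"
    by (rule continuous_map_eq) (simp add: q_def)
  have qe: "q (eval_emb A z) = z" if "z \<in> ball 0 1" for z
  proof -
    have "eval_emb A z \<in> topspace (K_top A)" using dense_K_top(1)[OF assms(1)] that by blast
    moreover have "eval_emb A z (c b) = z \<bullet> b" for b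
      using c[of b] that by (simp add: eval_emb_def c_def)
    ultimately show ?thesis by (simp add: q_def euclidean_representation)
  qed
  have q_cball: "q \<xi> \<in> cball 0 1" if "\<xi> \<in> topspace (K_top A)" for \<xi>
  proof -
    have "q ` (K_top A closure_of (eval_emb A ` ball 0 1)) \<subseteq> closure (q ` eval_emb A ` ball 0 1)"
      using continuous_map_image_closure_subset[OF cq] by auto
    moreover have "q ` eval_emb A ` ball 0 1 \<subseteq> cball 0 1"
      using qe by (force simp: less_imp_le)
    then have "closure (q ` eval_emb A ` ball 0 1) \<subseteq> cball 0 1"
      by (rule closure_minimal) simp
    ultimately have "q ` topspace (K_top A) \<subseteq> cball 0 1"
      using dense_K_top(2)[OF assms(1)] by (metis order_trans)
    then show ?thesis using that by (rule subsetD[OF _ imageI])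
  qed
  show ?thesis
  proof (intro ex1I[of _ q] conjI ballI)
    show "continuous_map (K_top A) (top_of_set (cball 0 1)) q"
      using cq q_cball by (auto simp: continuous_map_in_subtopology)
  next
    fix p assume p: "p \<in> extensional (topspace (K_top A)) \<and>
     continuous_map (K_top A) (top_of_set (cball 0 1)) p \<and>
     (\<forall>z\<in>ball 0 1. p (eval_emb A z) = z)"
    then have cp: "continuous_map (K_top A) euclidean p"
      by (simp add: continuous_map_in_subtopology)
    have "p \<xi> = q \<xi>" if "\<xi> \<in> topspace (K_top A)" for \<xi>
    proof (rule forall_in_closure_of_eq[OF _ _ cp cq])
      show "\<xi> \<in> K_top A closure_of (eval_emb A ` ball 0 1)"
        using that dense_K_top(2)[OF assms(1)] by simp
    qed (use p qe in auto)
    then show "p = q"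
      using p by (intro extensionalityI[of p "topspace (K_top A)" q]) (auto simp: q_def)
  qed (simp add: q_def, use qe in blast)
qed

lemma K_proj:
  assumes "A \<subseteq> mspace BC_ball" "C_cball \<subseteq> A"
  shows "continuous_map (K_top A) (top_of_set (cball 0 1)) (K_proj A)"
    "z \<in> ball 0 1 \<Longrightarrow> K_proj A (eval_emb A z) = z"
  using theI'[OF K_proj_ex1[OF assms], folded K_proj_def] by simp_all

lemma K_proj_surj:
  fixes A :: "('d::euclidean_space \<Rightarrow> real) set"
  assumes "A \<subseteq> mspace BC_ball" "C_cball \<subseteq> A"
  shows "K_proj A ` topspace (K_top A) = cball 0 1"
proof
  show "K_proj A ` topspace (K_top A) \<subseteq> cball 0 1"
    using continuous_map_image_subset_topspace[OF K_proj(1)[OF assms]] by simp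
  have "compactin (top_of_set (cball 0 1)) (K_proj A ` topspace (K_top A))"
    using K_proj(1)[OF assms] compact_K_top image_compactin compact_space_def by blast
  then have cl: "closed (K_proj A ` topspace (K_top A))"
    by (simp add: compactin_subtopology compact_imp_closed)
  have "ball 0 1 \<subseteq> K_proj A ` topspace (K_top A)"
  proof
    fix z :: 'd assume z: "z \<in> ball 0 1"
    then have "eval_emb A z \<in> topspace (K_top A)" using dense_K_top(1)[OF assms(1)] by blast
    then show "z \<in> K_proj A ` topspace (K_top A)" using K_proj(2)[OF assms z] by (metis imageI)
  qed
  then have "closure (ball 0 1) \<subseteq> K_proj A ` topspace (K_top A)"
    using cl by (rule closure_minimal)
  then show "cball 0 1 \<subseteq> K_proj A ` topspace (K_top A)"
    using closure_ball[of 1 "0::'d"] by simp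
qed

lemma K_proj_bdry:
  assumes "A \<subseteq> mspace BC_ball" "C_cball \<subseteq> A"
  shows "K_proj A ` bdry (K_top A) (eval_emb A) = sphere 0 1"
proof -
  define p where "p = K_proj A"
  define U where "U = {\<xi> \<in> topspace (K_top A). p \<xi> \<in> ball 0 1}"
  have cp: "continuous_map (K_top A) euclidean p"
    using K_proj(1)[OF assms] by (simp add: p_def continuous_map_in_subtopology)
  have oU: "openin (K_top A) U"
    unfolding U_def by (rule openin_continuous_map_preimage[OF cp]) auto
  have eU: "eval_emb A ` ball 0 1 \<subseteq> U"
    using dense_K_top(1)[OF assms(1)] K_proj(2)[OF assms] by (force simp: U_def p_def)
  have inj: "\<xi> = eval_emb A (p \<xi>)" if "\<xi> \<in> U" for \<xi>
  proof (rule extensionalityI[of _ A])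
    have "\<xi> \<in> topspace (cube_top A)" using that by (auto simp: U_def K_top_def)
    then show "\<xi> \<in> extensional A" by (auto simp: cube_top_def PiE_def)
    show "eval_emb A (p \<xi>) \<in> extensional A" by (simp add: eval_emb_def)
    fix g assume g: "g \<in> A"
    then have "continuous_map (top_of_set (ball 0 1)) euclideanreal g"
      using assms(1) by (auto simp: BC_ball_def)
    moreover have "continuous_map (subtopology (K_top A) U) (top_of_set (ball 0 1)) p"
      using cp by (auto simp: continuous_map_in_subtopology U_def intro: continuous_map_from_subtopology)
    ultimately have cg: "continuous_map (subtopology (K_top A) U) euclideanreal (\<lambda>\<xi>. g (p \<xi>))"
      by (metis (no_types, lifting) continuous_map_compose continuous_map_eq comp_apply)
    have "\<xi> g = g (p \<xi>)"
    proof (rule forall_in_closure_of_eq[OF _ _ _ cg])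
      show "\<xi> \<in> subtopology (K_top A) U closure_of (eval_emb A ` ball 0 1)"
        using that oU eU dense_K_top(2)[OF assms(1)]
        by (simp add: closure_of_subtopology_open U_def)
      show "continuous_map (subtopology (K_top A) U) euclideanreal (\<lambda>\<xi>. \<xi> g)"
        by (intro continuous_map_from_subtopology continuous_map_K_eval g)
    qed (use g K_proj(2)[OF assms] in \<open>auto simp: eval_emb_def p_def\<close>)
    then show "\<xi> g = eval_emb A (p \<xi>) g" using g by (simp add: eval_emb_def)
  qed
  have "U = eval_emb A ` ball 0 1"
  proof
    show "U \<subseteq> eval_emb A ` ball 0 1"
    proof
      fix \<xi> assume "\<xi> \<in> U"
      then have "\<xi> = eval_emb A (p \<xi>)" "p \<xi> \<in> ball 0 1" using inj by (auto simp: U_def)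
      then show "\<xi> \<in> eval_emb A ` ball 0 1" by blast
    qed
  qed (rule eU)
  then have bd: "bdry (K_top A) (eval_emb A) = {\<xi> \<in> topspace (K_top A). p \<xi> \<notin> ball 0 1}"
    by (auto simp: bdry_def U_def)
  have im: "p ` topspace (K_top A) = cball 0 1"
    using K_proj_surj[OF assms] by (simp add: p_def)
  have "p ` bdry (K_top A) (eval_emb A) = p ` topspace (K_top A) - ball 0 1"
    unfolding bd by auto
  then have "p ` bdry (K_top A) (eval_emb A) = cball 0 1 - ball 0 1" by (simp only: im)
  then show ?thesis by (simp add: p_def cball_diff_eq_sphere)
qed

lemma C_cball_subset: "C_cball \<subseteq> mspace BC_ball"
proof
  fix h :: "'a \<Rightarrow> real" assume "h \<in> C_cball"
  then obtain g where g: "continuous_on (cball 0 1) g" "h = restrict g (ball 0 1)"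
    by (auto simp: C_cball_def)
  have "bounded (g ` cball 0 1)"
    using g(1) by (intro compact_imp_bounded compact_continuous_image) auto
  then have "bounded (h ` ball 0 1)"
    by (rule bounded_subset) (auto simp: g(2))
  moreover have "continuous_on (ball 0 1) h"
    using continuous_on_subset[OF g(1) ball_subset_cball]
    by (rule continuous_on_eq) (simp add: g(2))
  ultimately show "h \<in> mspace BC_ball"
    by (auto simp: BC_ball_def Met_TC.fspace_def g(2))
qed

lemma sphere_compactification:
  defines "C \<equiv> C_cball :: ('d::euclidean_space \<Rightarrow> real) set"
  shows "homeomorphic_map (K_top C) (top_of_set (cball 0 1)) (K_proj C)"
proof (rule continuous_imp_homeomorphic_map)
  have C: "C \<subseteq> mspace BC_ball" "C_cball \<subseteq> C" by (simp_all add: C_def C_cball_subset)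
  note P = K_proj[OF C]
  show "continuous_map (K_top C) (top_of_set (cball 0 1)) (K_proj C)" by (rule P)
  show "K_proj C ` topspace (K_top C) = topspace (top_of_set (cball 0 1))"
    by (simp add: K_proj_surj[OF C])
  have cp: "continuous_map (K_top C) euclidean (K_proj C)"
    using P(1) by (simp add: continuous_map_in_subtopology)
  have val: "\<xi> (restrict g (ball 0 1)) = g (K_proj C \<xi>)"
    if "\<xi> \<in> topspace (K_top C)" and g: "continuous_on (cball 0 1) g" for \<xi> and g :: "'d \<Rightarrow> real"
  proof -
    have gA: "restrict g (ball 0 1) \<in> C" using g by (auto simp: C_def C_cball_def)
    have "continuous_map (top_of_set (cball 0 1)) euclideanreal g" using g by simp
    from continuous_map_compose[OF P(1) this]
    have cg: "continuous_map (K_top C) euclideanreal (\<lambda>\<xi>. g (K_proj C \<xi>))"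
      by (simp add: o_def)
    show ?thesis
    proof (rule forall_in_closure_of_eq[OF _ _ continuous_map_K_eval[OF gA] cg])
      show "\<xi> \<in> K_top C closure_of (eval_emb C ` ball 0 1)"
        using that dense_K_top(2)[OF C(1)] by simp
    qed (use gA P(2) in \<open>auto simp: eval_emb_def\<close>)
  qed
  show "inj_on (K_proj C) (topspace (K_top C))"
  proof (rule inj_onI)
    fix \<xi> \<zeta> :: "('d \<Rightarrow> real) \<Rightarrow> real"
    assume x: "\<xi> \<in> topspace (K_top C)" "\<zeta> \<in> topspace (K_top C)"
      and eq: "K_proj C \<xi> = K_proj C \<zeta>"
    then have "\<xi> \<in> extensional C" "\<zeta> \<in> extensional C"
      by (auto simp: K_top_def cube_top_def PiE_def)
    then show "\<xi> = \<zeta>"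
    proof (rule extensionalityI)
      fix h assume "h \<in> C"
      then obtain g where "h = restrict g (ball 0 1)" "continuous_on (cball 0 1) g"
        by (auto simp: C_def C_cball_def)
      then show "\<xi> h = \<zeta> h" using val x eq by metis
    qed
  qed
qed (auto simp: compact_K_top intro: Hausdorff_space_subtopology)

lemma sets_borel_of_top_of_set:
  assumes "S \<in> sets borel"
  shows "sets (borel_of (top_of_set S)) = sets (restrict_space borel S)"
proof -
  have "sets (restrict_space borel S) = sigma_sets S ((\<inter>) S ` {U. open U})"
    using assms by (simp add: sets_restrict_space borel_def sigma_sets_Int)
  moreover have "(\<inter>) S ` {U. open U} = {U. openin (top_of_set S) U}"
    by (auto simp: openin_open)
  moreover have "{U. openin (top_of_set S) U} \<subseteq> Pow S"
    using openin_imp_subset by auto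
  ultimately show ?thesis by (simp add: borel_of_def)
qed

lemma sets_bdry_borel_sphere:
  "sets (bdry_borel (top_of_set (cball 0 1)) (\<lambda>z. z)) =
   sets (restrict_space borel (sphere (0::'d::euclidean_space) 1))"
proof -
  have "bdry (top_of_set (cball 0 1)) (\<lambda>z::'d. z) = sphere 0 1"
    by (auto simp: bdry_def)
  moreover have "cball 0 1 \<inter> sphere 0 1 = sphere (0::'d) 1" by auto
  ultimately show ?thesis
    by (simp add: bdry_borel_def subtopology_subtopology sets_borel_of_top_of_set)
qed

end

theory Submission
  imports Defs
begin

text \<open>Pushing \<open>\<nu>i\<close> and \<open>\<eta>i\<close> forward to the sphere reduces everything to the sphere compactification,
  where \<open>F\<close> on \<open>K_top A\<close> is replaced by \<open>F \<circ> K_proj A\<close>. Two classes of integrands then suffice.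

  For bounded \<open>f\<close> the recession function vanishes. If moreover \<open>f\<close> is Lipschitz with bounded support, then
  \<open>a(x) f(z / a(x))\<close> is approximated uniformly in \<open>z\<close> by replacing the scale \<open>1 / a\<close> with simple functions,
  so the limit of \<open>\<integral> \<phi> a f(v\<^sub>j / a) d\<mu>\<close> can be computed from \<open>\<nu>\<close> as well as from \<open>\<eta>\<close>;
  comparing the two identifies \<open>\<eta>\<close>.

  For \<open>h\<close> positively homogeneous of degree one, \<open>a h(v\<^sub>j / a) = h(v\<^sub>j)\<close>, so both Young limits agree, and by the
  first step so do their oscillation parts. Hence the concentration parts agree; \<open>h = norm\<close> gives
  \<open>lam_nu = lam_eta\<close>, and a countable determining family of \<open>h\<close> gives the measures on the sphere.\<close>

section \<open>Bump functions on rational boxes determine finite measures\<close>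

text \<open>Rational corners make this a countable base of bounded open sets that is closed under
  intersection. Countability allows the exceptional null sets of almost-everywhere statements to be
  united, stability feeds the pi-system arguments, and boundedness gives the test functions below
  bounded support.\<close>

definition rational_boxes_set :: "'n::euclidean_space set set" where
  "rational_boxes_set = {box r s |r s. \<forall>i\<in>Basis. r \<bullet> i \<in> \<rat> \<and> s \<bullet> i \<in> \<rat>}"

lemma rational_boxes_setI:
  "(\<And>i. i \<in> Basis \<Longrightarrow> r \<bullet> i \<in> \<rat> \<and> s \<bullet> i \<in> \<rat>) \<Longrightarrow> box r s \<in> rational_boxes_set"
  by (auto simp: rational_boxes_set_def)

lemma countable_rational_boxes_set: "countable (rational_boxes_set :: 'n::euclidean_space set set)"
proof -
  let ?a = "\<lambda>f. (\<Sum>(i::'n)\<in>Basis. fst (f i) *\<^sub>R i)"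
  let ?b = "\<lambda>f. (\<Sum>(i::'n)\<in>Basis. snd (f i) *\<^sub>R i)"
  have "rational_boxes_set \<subseteq> (\<lambda>f. box (?a f) (?b f)) ` (Basis \<rightarrow>\<^sub>E \<rat> \<times> \<rat>)"
  proof
    fix U :: "'n set" assume "U \<in> rational_boxes_set"
    then obtain r s where U: "U = box r s" "\<forall>i\<in>Basis. r \<bullet> i \<in> \<rat> \<and> s \<bullet> i \<in> \<rat>"
      by (auto simp: rational_boxes_set_def)
    show "U \<in> (\<lambda>f. box (?a f) (?b f)) ` (Basis \<rightarrow>\<^sub>E \<rat> \<times> \<rat>)"
      by (rule image_eqI[of _ _ "\<lambda>i\<in>Basis. (r \<bullet> i, s \<bullet> i)"])
        (use U in \<open>auto simp: euclidean_representation\<close>)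
  qed
  then show ?thesis
    by (rule countable_subset) (simp add: countable_PiE countable_rat)
qed

lemma Int_stable_rational_boxes_set: "Int_stable (rational_boxes_set :: 'n::euclidean_space set set)"
  unfolding Int_stable_def
proof (intro ballI)
  fix U V :: "'n set" assume "U \<in> rational_boxes_set" "V \<in> rational_boxes_set"
  then obtain r s r' s' where
    "U = box r s" "\<forall>i\<in>Basis. r \<bullet> i \<in> \<rat> \<and> s \<bullet> i \<in> \<rat>"
    "V = box r' s'" "\<forall>i\<in>Basis. r' \<bullet> i \<in> \<rat> \<and> s' \<bullet> i \<in> \<rat>"
    by (auto simp: rational_boxes_set_def)
  then show "U \<inter> V \<in> rational_boxes_set"
    by (auto simp: box_Int_box max_def min_def intro!: rational_boxes_setI)
qed

lemma topological_basis_rational_boxes_set: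
  "topological_basis (rational_boxes_set :: 'n::euclidean_space set set)"
proof (rule topological_basisI)
  fix U :: "'n set" and x assume "open U" "x \<in> U"
  then obtain e where "e > 0" "ball x e \<subseteq> U" by (rule openE)
  moreover from rational_boxes[OF this(1), of x] obtain r s where
    "\<forall>i\<in>Basis. r \<bullet> i \<in> \<rat> \<and> s \<bullet> i \<in> \<rat>" "x \<in> box r s" "box r s \<subseteq> ball x e" by auto
  ultimately show "\<exists>B\<in>rational_boxes_set. x \<in> B \<and> B \<subseteq> U"
    by (intro bexI[of _ "box r s"] rational_boxes_setI) auto
qed (auto simp: rational_boxes_set_def open_box)

lemma sets_borel_rational_boxes_set:
  "sets borel = sigma_sets UNIV (rational_boxes_set :: 'n::euclidean_space set set)"
  by (subst borel_eq_countable_basis[OF countable_rational_boxes_set topological_basis_rational_boxes_set])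
    (simp add: sets_measure_of)

lemma Union_rational_boxes_set: "\<Union> rational_boxes_set = (UNIV :: 'n::euclidean_space set)"
proof -
  have "x \<in> \<Union> rational_boxes_set" for x :: 'n
    by (rule topological_basisE[OF topological_basis_rational_boxes_set open_UNIV UNIV_I[of x]]) (rule UnionI)
  then show ?thesis by auto
qed

lemma rational_boxes_set_D:
  assumes "U \<in> rational_boxes_set"
  shows "open U" "bounded U" "- U \<noteq> {}"
proof -
  show "open U" "bounded U" using assms by (auto simp: rational_boxes_set_def open_box)
  then show "- U \<noteq> {}" using not_bounded_UNIV by (metis Compl_empty_eq double_compl)
qed

section \<open>Lipschitz approximations of indicators of open sets\<close>

definition bump :: "'n::metric_space set \<Rightarrow> nat \<Rightarrow> 'n \<Rightarrow> real" where
  "bump U k x = min 1 (real k * infdist x (- U))"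

lemma bump_range: "0 \<le> bump U k x" "bump U k x \<le> 1" "\<bar>bump U k x\<bar> \<le> 1"
  by (auto simp: bump_def infdist_nonneg)

lemma continuous_on_bump [continuous_intros]:
  "continuous_on S g \<Longrightarrow> continuous_on S (\<lambda>x. bump U k (g x))"
  unfolding bump_def by (intro continuous_intros)

lemma bump_outside: "x \<notin> U \<Longrightarrow> bump U k x = 0"
  by (simp add: bump_def)

lemma bump_lipschitz: "\<bar>bump U k x - bump U k y\<bar> \<le> real k * dist x y"
proof -
  have "\<bar>bump U k x - bump U k y\<bar> \<le> \<bar>real k * infdist x (- U) - real k * infdist y (- U)\<bar>"
    unfolding bump_def by linarith
  also have "\<dots> = real k * \<bar>infdist x (- U) - infdist y (- U)\<bar>"
    by (simp add: abs_mult flip: right_diff_distrib)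
  also have "\<dots> \<le> real k * dist x y"
    by (intro mult_left_mono infdist_triangle_abs) simp
  finally show ?thesis .
qed

text \<open>At a point of \<open>U\<close> the distance to the closed complement is positive, so the
  truncation at 1 is active for large \<open>k\<close>; outside \<open>U\<close> every bump
  vanishes. The complement must be nonempty because \<open>infdist\<close> to the empty set is 0,
  which would make the bumps of the whole space vanish identically.\<close>

lemma bump_tendsto_indicator:
  assumes "open U" "- U \<noteq> {}"
  shows "(\<lambda>k. bump U k x) \<longlonglongrightarrow> indicator U x"
proof (cases "x \<in> U")
  case True
  then have pos: "infdist x (- U) > 0"
    using assms in_closed_iff_infdist_zero[of "- U" x] infdist_nonneg[of x "- U"]
    by (auto simp: closed_Compl less_le)
  then obtain N where N: "1 < real N * infdist x (- U)"
    using ex_less_of_nat_mult by blast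
  have "bump U k x = 1" if "k \<ge> N" for k
  proof -
    have "real N * infdist x (- U) \<le> real k * infdist x (- U)"
      using that pos by (intro mult_right_mono) auto
    then show ?thesis using N by (simp add: bump_def)
  qed
  then have "eventually (\<lambda>k. bump U k x = indicator U x) sequentially"
    using True by (auto simp: eventually_sequentially)
  then show ?thesis by (rule tendsto_eventually)
qed (simp add: bump_outside)

lemma borel_measurable_bump [measurable]: "bump U k \<in> borel_measurable borel"
  by (intro borel_measurable_continuous_onI continuous_intros)

section \<open>Measures and densities determined by their bump integrals\<close>

lemma measurable_of_borel_restrict:
  "f \<in> borel_measurable borel \<Longrightarrow> sets M = sets (restrict_space borel S) \<Longrightarrow> f \<in> borel_measurable M"
  by (subst measurable_cong_sets[OF _ refl]) (assumption, rule measurable_restrict_space1)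

text \<open>Dominated convergence turns equality of bump integrals into equality on rational boxes,
  an intersection-stable generator of the Borel sets. Since the measures live on the trace of the
  Borel sets on \<open>S\<close>, they are first pushed to the whole space by the identity map;
  every measurable set is a trace \<open>S \<inter> B\<close>, so nothing is lost.\<close>

lemma finite_measure_eqI_bump:
  fixes M N :: "'n::euclidean_space measure"
  assumes "finite_measure M" "finite_measure N"
    and sM: "sets M = sets (restrict_space borel S)" and sN: "sets N = sets (restrict_space borel S)"
    and eq: "\<And>U k. U \<in> rational_boxes_set \<Longrightarrow> (\<integral>x. bump U k x \<partial>M) = (\<integral>x. bump U k x \<partial>N)"
  shows "M = N"
proof -
  have lim: "(\<lambda>k. \<integral>x. bump U k x \<partial>M) \<longlonglongrightarrow> measure (distr M borel (\<lambda>x. x)) U"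
    and m: "(\<lambda>x. x) \<in> M \<rightarrow>\<^sub>M borel"
    if "finite_measure M" "sets M = sets (restrict_space borel S)" "U \<in> rational_boxes_set"
    for M :: "'n measure" and U
  proof -
    interpret finite_measure M by fact
    show [measurable]: "(\<lambda>x. x) \<in> M \<rightarrow>\<^sub>M borel"
      by (subst measurable_cong_sets[OF that(2) refl]) (rule measurable_restrict_space1, simp)
    have [measurable]: "bump U k \<in> borel_measurable M" for k
      by (rule measurable_of_borel_restrict[OF _ that(2)]) simp
    have [measurable]: "U \<in> sets borel" using rational_boxes_set_D(1)[OF that(3)] by simp
    have "(\<lambda>k. \<integral>x. bump U k x \<partial>M) \<longlonglongrightarrow> (\<integral>x. (indicator U x :: real) \<partial>M)"
    proof (rule integral_dominated_convergence[where w="\<lambda>_. 1"])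
      show "(\<lambda>x. indicator U x :: real) \<in> borel_measurable M" by measurable
    qed (auto simp: bump_range intro!: bump_tendsto_indicator rational_boxes_set_D[OF that(3)])
    also have "(\<integral>x. (indicator U x :: real) \<partial>M) = (\<integral>x. (indicator U x :: real) \<partial>(distr M borel (\<lambda>x. x)))"
      by (subst integral_distr) auto
    also have "\<dots> = measure (distr M borel (\<lambda>x. x)) U" by simp
    finally show "(\<lambda>k. \<integral>x. bump U k x \<partial>M) \<longlonglongrightarrow> measure (distr M borel (\<lambda>x. x)) U" .
  qed
  interpret M: finite_measure M by fact
  interpret N: finite_measure N by fact
  have mM: "(\<lambda>x. x) \<in> M \<rightarrow>\<^sub>M borel" and mN: "(\<lambda>x. x) \<in> N \<rightarrow>\<^sub>M borel"
    using m[OF assms(1) sM] m[OF assms(2) sN] Union_rational_boxes_set by blast+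
  interpret M': finite_measure "distr M borel (\<lambda>x. x)" by (rule M.finite_measure_distr[OF mM])
  interpret N': finite_measure "distr N borel (\<lambda>x. x)" by (rule N.finite_measure_distr[OF mN])
  have D: "distr M borel (\<lambda>x. x) = distr N borel (\<lambda>x. x)"
  proof (rule measure_eqI_generator_eq_countable[where \<Omega>=UNIV and A=rational_boxes_set,
        OF Int_stable_rational_boxes_set])
    fix U :: "'n set" assume U: "U \<in> rational_boxes_set"
    have "(\<lambda>k. \<integral>x. bump U k x \<partial>M) = (\<lambda>k. \<integral>x. bump U k x \<partial>N)"
      using eq[OF U] by simp
    then have "measure (distr M borel (\<lambda>x. x)) U = measure (distr N borel (\<lambda>x. x)) U"
      using LIMSEQ_unique lim[OF assms(1) sM U] lim[OF assms(2) sN U] by metis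
    then show "emeasure (distr M borel (\<lambda>x. x)) U = emeasure (distr N borel (\<lambda>x. x)) U"
      by (simp add: M'.emeasure_eq_measure N'.emeasure_eq_measure)
  qed (auto simp: sets_borel_rational_boxes_set Union_rational_boxes_set countable_rational_boxes_set
      M'.emeasure_eq_measure)
  show ?thesis
  proof (rule measure_eqI)
    fix A assume A: "A \<in> sets M"
    then obtain B where B: "B \<in> sets borel" "A = S \<inter> B" by (auto simp: sM sets_restrict_space)
    have sp: "space M = S" "space N = S"
      using sets_eq_imp_space_eq[OF sM] sets_eq_imp_space_eq[OF sN] by (auto simp: space_restrict_space)
    have "emeasure M A = emeasure (distr M borel (\<lambda>x. x)) B"
      using B mM sp by (simp add: emeasure_distr Int_commute)
    also have "\<dots> = emeasure N A"
      unfolding D using B mN sp by (simp add: emeasure_distr Int_commute)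
    finally show "emeasure M A = emeasure N A" .
  qed (simp add: sM sN)
qed

text \<open>The positive and negative parts of \<open>u - w\<close> serve as densities of two finite
  measures. Equal bump integrals make these measures equal, and densities are unique almost
  everywhere.\<close>

lemma AE_eq_of_integral_bump_eq:
  fixes M :: "'n::euclidean_space measure" and u w :: "'n \<Rightarrow> real"
  assumes sM: "sets M = sets (restrict_space borel S)"
    and int: "integrable M u" "integrable M w"
    and eq: "\<And>U k. U \<in> rational_boxes_set \<Longrightarrow> (\<integral>x. bump U k x * u x \<partial>M) = (\<integral>x. bump U k x * w x \<partial>M)"
  shows "AE x in M. u x = w x"
proof -
  define h where "h x = u x - w x" for x
  have h: "integrable M h" unfolding h_def[abs_def] using int by (rule Bochner_Integration.integrable_diff)
  define p n where "p x = max 0 (h x)" and "n x = max 0 (- h x)" for x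
  have [measurable]: "h \<in> borel_measurable M" using h by simp
  have pn: "integrable M p" "integrable M n"
    using h unfolding p_def[abs_def] n_def[abs_def] by (auto intro: integrable_max)
  have [measurable]: "p \<in> borel_measurable M" "n \<in> borel_measurable M" using pn by auto
  have nn: "0 \<le> p x" "0 \<le> n x" for x by (auto simp: p_def n_def)
  have "density M (\<lambda>x. ennreal (p x)) = density M (\<lambda>x. ennreal (n x))"
  proof (rule finite_measure_eqI_bump)
    show "finite_measure (density M (\<lambda>x. ennreal (p x)))" "finite_measure (density M (\<lambda>x. ennreal (n x)))"
      using pn nn by (auto intro!: finite_measureI simp: emeasure_density nn_integral_eq_integral
          cong: nn_integral_cong_simp)
    fix U :: "'n set" and k assume U: "U \<in> rational_boxes_set"
    have [measurable]: "bump U k \<in> borel_measurable M"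
      by (rule measurable_of_borel_restrict[OF _ sM]) simp
    have i: "integrable M (\<lambda>x. bump U k x * g x)" if "integrable M g" for g
      using that by (rule Bochner_Integration.integrable_bound)
        (use that in \<open>auto simp: abs_mult bump_range intro!: mult_left_le_one_le\<close>)
    have "(\<integral>x. bump U k x * p x \<partial>M) - (\<integral>x. bump U k x * n x \<partial>M) = (\<integral>x. bump U k x * p x - bump U k x * n x \<partial>M)"
      by (intro Bochner_Integration.integral_diff[symmetric] i pn)
    also have "\<dots> = (\<integral>x. bump U k x * u x - bump U k x * w x \<partial>M)"
      by (intro Bochner_Integration.integral_cong) (auto simp: p_def n_def h_def max_def algebra_simps)
    also have "\<dots> = 0"
      using eq[OF U] by (subst Bochner_Integration.integral_diff) (auto intro: i int)
    finally show "(\<integral>x. bump U k x \<partial>density M (\<lambda>x. ennreal (p x))) = (\<integral>x. bump U k x \<partial>density M (\<lambda>x. ennreal (n x)))"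
      using nn by (simp add: integral_density mult.commute)
  qed (simp_all add: sM)
  then have "AE x in M. ennreal (p x) = ennreal (n x)"
    using pn nn by (subst (asm) finite_density_unique) (auto simp: nn_integral_eq_integral)
  \<comment> \<open>At most one of \<open>p x\<close> and \<open>n x\<close> is nonzero, so their
    equality forces both to be 0.\<close>
  then show ?thesis
    by eventually_elim (use nn in \<open>auto simp: p_def n_def h_def max_def split: if_splits\<close>)
qed

section \<open>Integrable multipliers and variable scales\<close>

text \<open>A three-epsilon argument: the error \<open>e k\<close> does not depend on
  \<open>j\<close>, so one sufficiently large \<open>k\<close> serves for the whole sequence and for
  its limit.\<close>

lemma tendsto_of_uniform_approx:
  fixes X :: "nat \<Rightarrow> nat \<Rightarrow> real"
  assumes "\<And>k. X k \<longlonglongrightarrow> Y k" "\<And>k j. \<bar>X k j - Z j\<bar> \<le> e k" "\<And>k. \<bar>Y k - L\<bar> \<le> e k" "e \<longlonglongrightarrow> 0"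
  shows "Z \<longlonglongrightarrow> L"
proof (rule LIMSEQ_I)
  fix r :: real assume "r > 0"
  then have "\<exists>N. \<forall>k\<ge>N. norm (e k - 0) < r / 3"
    using LIMSEQ_D[OF assms(4)] by (metis zero_less_divide_iff zero_less_numeral)
  then obtain k where "norm (e k - 0) < r / 3" by blast
  then have k: "e k < r / 3" by simp
  obtain N where N: "\<And>j. j \<ge> N \<Longrightarrow> norm (X k j - Y k) < r / 3"
    using LIMSEQ_D[OF assms(1)[of k], of "r / 3"] \<open>r > 0\<close> by auto
  have "norm (Z j - L) < r" if "j \<ge> N" for j
    using N[OF that] k assms(2)[of k j] assms(3)[of k]
    unfolding real_norm_def by linarith
  then show "\<exists>N. \<forall>j\<ge>N. norm (Z j - L) < r" by blast
qed

lemma integrable_mult_bounded: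
  fixes f g :: "'n \<Rightarrow> real"
  assumes "integrable N g" "f \<in> borel_measurable N" "\<And>x. x \<in> space N \<Longrightarrow> \<bar>f x\<bar> \<le> C"
  shows "integrable N (\<lambda>x. g x * f x)"
proof (rule Bochner_Integration.integrable_bound)
  show "integrable N (\<lambda>x. C * g x)" using assms by simp
  show "(\<lambda>x. g x * f x) \<in> borel_measurable N" using assms by simp
  show "AE x in N. norm (g x * f x) \<le> norm (C * g x)"
  proof (rule AE_I2)
    fix x assume "x \<in> space N"
    then have "\<bar>f x\<bar> \<le> \<bar>C\<bar>" using assms(3)[of x] by linarith
    then show "norm (g x * f x) \<le> norm (C * g x)"
      by (simp add: abs_mult mult.commute[of "\<bar>C\<bar>"] mult_left_mono)
  qed
qed

text \<open>The common bound \<open>C\<close> on \<open>w j\<close> and \<open>u\<close> reduces the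
  effect of replacing \<psi> by \<open>s k\<close> to \<open>C\<close> times an L1 distance of
  multipliers. This distance is independent of \<open>j\<close> and tends to 0 by dominated
  convergence.\<close>

lemma integral_mult_tendsto_approx:
  fixes N :: "'n measure" and w :: "nat \<Rightarrow> 'n \<Rightarrow> real"
  assumes [measurable]: "\<And>j. w j \<in> borel_measurable N" "u \<in> borel_measurable N"
    and bd: "\<And>j x. x \<in> space N \<Longrightarrow> \<bar>w j x\<bar> \<le> C" "\<And>x. x \<in> space N \<Longrightarrow> \<bar>u x\<bar> \<le> C"
    and conv: "\<And>k. (\<lambda>j. \<integral>x. s k x * w j x \<partial>N) \<longlonglongrightarrow> (\<integral>x. s k x * u x \<partial>N)"
    and [measurable]: "\<And>k. s k \<in> borel_measurable N" "\<psi> \<in> borel_measurable N"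
    and h: "integrable N h" "\<And>k x. x \<in> space N \<Longrightarrow> \<bar>s k x\<bar> \<le> h x"
    and lim: "\<And>x. x \<in> space N \<Longrightarrow> (\<lambda>k. s k x) \<longlonglongrightarrow> \<psi> x"
  shows "(\<lambda>j. \<integral>x. \<psi> x * w j x \<partial>N) \<longlonglongrightarrow> (\<integral>x. \<psi> x * u x \<partial>N)"
proof -
  have [measurable]: "h \<in> borel_measurable N" using h by simp
  have ps: "\<bar>\<psi> x\<bar> \<le> h x" if "x \<in> space N" for x
    by (rule tendsto_upperbound[OF tendsto_rabs[OF lim[OF that]]]) (simp_all add: h that)
  have sint: "integrable N (s k)" for k
    by (rule Bochner_Integration.integrable_bound[OF h(1)]) (auto intro!: AE_I2 order_trans[OF h(2)])
  have ip: "integrable N \<psi>"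
    by (rule Bochner_Integration.integrable_bound[OF h(1)]) (auto intro!: AE_I2 order_trans[OF ps])
  define e where "e k = \<bar>C\<bar> * (\<integral>x. \<bar>s k x - \<psi> x\<bar> \<partial>N)" for k
  have err: "\<bar>(\<integral>x. s k x * f x \<partial>N) - (\<integral>x. \<psi> x * f x \<partial>N)\<bar> \<le> e k"
    if [measurable]: "f \<in> borel_measurable N" and b: "\<And>x. x \<in> space N \<Longrightarrow> \<bar>f x\<bar> \<le> C" for f k
  proof -
    have "(\<integral>x. s k x * f x \<partial>N) - (\<integral>x. \<psi> x * f x \<partial>N) = (\<integral>x. (s k x - \<psi> x) * f x \<partial>N)"
      by (subst Bochner_Integration.integral_diff[symmetric]) (auto intro!: integrable_mult_bounded[where C=C] sint ip b simp: left_diff_distrib)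
    also have "\<bar>\<dots>\<bar> \<le> (\<integral>x. \<bar>(s k x - \<psi> x) * f x\<bar> \<partial>N)"
      using integral_norm_bound[of N "\<lambda>x. (s k x - \<psi> x) * f x"] by simp
    also have "\<dots> \<le> (\<integral>x. \<bar>C\<bar> * \<bar>s k x - \<psi> x\<bar> \<partial>N)"
    proof (rule integral_mono)
      show "integrable N (\<lambda>x. \<bar>(s k x - \<psi> x) * f x\<bar>)"
        by (intro integrable_abs integrable_mult_bounded[where C=C] Bochner_Integration.integrable_diff sint ip b) simp_all
      show "integrable N (\<lambda>x. \<bar>C\<bar> * \<bar>s k x - \<psi> x\<bar>)"
        by (intro integrable_mult_right integrable_abs Bochner_Integration.integrable_diff sint ip)
      show "\<bar>(s k x - \<psi> x) * f x\<bar> \<le> \<bar>C\<bar> * \<bar>s k x - \<psi> x\<bar>" if "x \<in> space N" for x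
      proof -
        have "\<bar>f x\<bar> \<le> \<bar>C\<bar>" using b[OF that] by linarith
        then show ?thesis by (simp add: abs_mult mult.commute[of "\<bar>C\<bar>"] mult_left_mono)
      qed
    qed
    also have "\<dots> = e k" by (simp add: e_def)
    finally show ?thesis .
  qed
  have "(\<lambda>k. \<integral>x. \<bar>s k x - \<psi> x\<bar> \<partial>N) \<longlonglongrightarrow> (\<integral>x. \<bar>\<psi> x - \<psi> x\<bar> \<partial>N)"
  proof (rule integral_dominated_convergence[where w="\<lambda>x. 2 * h x"])
    show "AE x in N. (\<lambda>k. \<bar>s k x - \<psi> x\<bar>) \<longlonglongrightarrow> \<bar>\<psi> x - \<psi> x\<bar>"
      by (intro AE_I2 tendsto_intros lim)
    show "AE x in N. norm \<bar>s k x - \<psi> x\<bar> \<le> 2 * h x" for k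
    proof (rule AE_I2)
      fix x assume "x \<in> space N"
      then show "norm \<bar>s k x - \<psi> x\<bar> \<le> 2 * h x" using h(2)[of x k] ps[of x] by simp
    qed
  qed (use h in auto)
  then have "e \<longlonglongrightarrow> 0"
    unfolding e_def by (intro tendsto_mult_right_zero) simp
  then show ?thesis
    by (rule tendsto_of_uniform_approx[OF conv, rotated 2]) (auto intro!: err bd)
qed

text \<open>The uniform bound on \<open>w\<close> lets the multiplier pass from continuous functions to \<open>L\<^sup>1\<close>
  by density; densities such as \<open>a\<close> are then admissible multipliers.\<close>

lemma integral_mult_tendsto_integrable:
  fixes M :: "'n::euclidean_space measure" and w :: "nat \<Rightarrow> 'n \<Rightarrow> real"
  assumes "finite_measure M" and sM: "sets M = sets (restrict_space borel S)"
    and wm: "\<And>j. w j \<in> borel_measurable (completion M)" and um: "u \<in> borel_measurable (completion M)"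
    and wb: "\<And>j x. x \<in> space M \<Longrightarrow> \<bar>w j x\<bar> \<le> C" and ub: "\<And>x. x \<in> space M \<Longrightarrow> \<bar>u x\<bar> \<le> C"
    and conv: "\<And>\<phi>. continuous_on UNIV \<phi> \<Longrightarrow>
      (\<lambda>j. \<integral>x. \<phi> x * w j x \<partial>completion M) \<longlonglongrightarrow> (\<integral>x. \<phi> x * u x \<partial>completion M)"
    and \<psi>: "integrable M \<psi>"
  shows "(\<lambda>j. \<integral>x. \<psi> x * w j x \<partial>completion M) \<longlonglongrightarrow> (\<integral>x. \<psi> x * u x \<partial>completion M)"
proof -
  interpret M: finite_measure M by fact
  interpret N: finite_measure "completion M"
    by (rule finite_measureI) simp
  \<comment> \<open>\<open>P\<close> singles out the multipliers for which convergence holds. It is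
    shown to be closed under linear combinations and dominated pointwise limits, and is then
    enlarged from continuous functions to indicators and to integrable functions.\<close>
  define P where "P \<psi> \<longleftrightarrow>
    (\<lambda>j. \<integral>x. \<psi> x * w j x \<partial>completion M) \<longlonglongrightarrow> (\<integral>x. \<psi> x * u x \<partial>completion M)" for \<psi>
  have spM: "space M = S"
    using sets_eq_imp_space_eq[OF sM] by (auto simp: space_restrict_space)
  have bm: "f \<in> borel_measurable (completion M)" if "f \<in> borel_measurable borel" for f :: "'n \<Rightarrow> real"
    by (rule measurable_completion[OF measurable_of_borel_restrict[OF that sM]])
  \<comment> \<open>The coefficient covers three later uses: -1 for complements, 1 for disjoint
    unions and sums, and an arbitrary \<open>c\<close> with \<open>f\<close> equal to 0 for
    multiples of indicators.\<close>
  have addP: "P (\<lambda>x. f x + c * g x)" if "integrable (completion M) f" "integrable (completion M) g" "P f" "P g"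
    for f g and c :: real
  proof -
    have "(\<integral>x. (f x + c * g x) * v x \<partial>completion M) =
        (\<integral>x. f x * v x \<partial>completion M) + c * (\<integral>x. g x * v x \<partial>completion M)"
      if "v \<in> borel_measurable (completion M)" "\<And>x. x \<in> space M \<Longrightarrow> \<bar>v x\<bar> \<le> C" for v
      unfolding integral_mult_right_zero[symmetric]
      by (subst Bochner_Integration.integral_add[symmetric])
        (auto intro!: integrable_mult_bounded[where C=C] integrable_mult_right that \<open>integrable (completion M) f\<close> \<open>integrable (completion M) g\<close>
          simp: algebra_simps)
    from this[OF wm wb] this[OF um ub] show ?thesis
      using that unfolding P_def by (auto intro!: tendsto_intros)
  qed
  have approx: "P f" if "\<And>k. P (s k)" "\<And>k. s k \<in> borel_measurable (completion M)"
    "f \<in> borel_measurable (completion M)" "integrable (completion M) h"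
    "\<And>k x. x \<in> space M \<Longrightarrow> \<bar>s k x\<bar> \<le> h x" "\<And>x. x \<in> space M \<Longrightarrow> (\<lambda>k. s k x) \<longlonglongrightarrow> f x"
    for s f h
    unfolding P_def
    by (rule integral_mult_tendsto_approx[where C=C and s=s and h=h])
      (use wm um wb ub that in \<open>auto simp: P_def\<close>)
  have one: "integrable (completion M) (\<lambda>_. 1 :: real)" by simp
  \<comment> \<open>Dynkin induction starting from rational boxes, whose indicators are limits of
    bumps. Countable disjoint unions are reached through their finite partial unions.\<close>
  have ind: "P (indicator B)" if "B \<in> sets borel" for B
    using that unfolding sets_borel_rational_boxes_set
  proof (induction rule: sigma_sets_induct_disjoint[OF Int_stable_rational_boxes_set subset_Pow_Union[of rational_boxes_set,
          unfolded Union_rational_boxes_set], consumes 1, case_names basic empty compl union])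
    case (basic U)
    show ?case
    proof (rule approx[of "bump U" _ "\<lambda>_. 1"])
      show "P (bump U k)" for k
        unfolding P_def by (rule conv) (intro continuous_intros)
      show "(\<lambda>k. bump U k x) \<longlonglongrightarrow> indicator U x" for x
        by (rule bump_tendsto_indicator) (use rational_boxes_set_D[OF basic] in auto)
      show "(indicator U :: _ \<Rightarrow> real) \<in> borel_measurable (completion M)"
        using rational_boxes_set_D[OF basic] by (intro bm) auto
    qed (auto intro: bm simp: bump_range)
  next
    case empty
    then show ?case by (simp add: P_def)
  next
    case (compl A)
    then have [measurable]: "A \<in> sets borel" by (simp add: sets_borel_rational_boxes_set)
    have "P (\<lambda>x. 1 + (- 1) * indicator A x)"
    proof (rule addP)
      show "P (\<lambda>_. 1)" unfolding P_def by (rule conv) simp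
      show "integrable (completion M) (indicator A :: _ \<Rightarrow> real)"
        by (rule Bochner_Integration.integrable_bound[OF one]) (auto intro!: bm)
    qed (use one compl in auto)
    moreover have "(\<lambda>x. 1 + (- 1) * indicator A x :: real) = indicator (UNIV - A)"
      by (auto simp: indicator_def fun_eq_iff)
    ultimately show ?case by simp
  next
    case (union A)
    then have mA[measurable]: "\<And>i. A i \<in> sets borel" by (auto simp: sets_borel_rational_boxes_set)
    have i: "integrable (completion M) (indicator B :: _ \<Rightarrow> real)" if "B \<in> sets borel" for B
      using that by (intro Bochner_Integration.integrable_bound[OF one]) (auto intro!: bm)
    have fin: "P (indicator (\<Union>i<n. A i))" for n
    proof (induction n)
      case (Suc n)
      have "P (\<lambda>x. indicator (\<Union>i<n. A i) x + 1 * indicator (A n) x)"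
        by (rule addP) (use Suc union(3) in \<open>auto intro!: i\<close>)
      moreover have "(\<lambda>x. indicator (\<Union>i<n. A i) x + 1 * indicator (A n) x :: real) = indicator (\<Union>i<Suc n. A i)"
      proof
        fix x
        have "(\<Union>i<n. A i) \<inter> A n = {}"
          using union(1) by (auto simp: disjoint_family_on_def) (metis disjoint_iff less_irrefl)
        then show "indicator (\<Union>i<n. A i) x + 1 * indicator (A n) x = (indicator (\<Union>i<Suc n. A i) x :: real)"
          by (auto simp: lessThan_Suc indicator_def)
      qed
      ultimately show ?case by simp
    qed (simp add: P_def)
    show ?case
    proof (rule approx[of "\<lambda>n. indicator (\<Union>i<n. A i)" _ "\<lambda>_. 1"])
      show "(\<lambda>n. indicator (\<Union>i<n. A i) x) \<longlonglongrightarrow> (indicator (\<Union>i. A i) x :: real)" for x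
        by (rule LIMSEQ_indicator_UN)
    qed (auto intro!: fin bm simp: indicator_def)
  qed
  have "P \<psi>" using \<psi>
  proof induction
    case (base A c)
    then obtain B where B: "B \<in> sets borel" "A = S \<inter> B" by (auto simp: sM sets_restrict_space)
    then have "integrable (completion M) (indicator B :: _ \<Rightarrow> real)"
      by (intro Bochner_Integration.integrable_bound[OF one]) (auto intro!: bm)
    then have "P (\<lambda>x. 0 + c * indicator B x)"
      by (intro addP ind B) (auto simp: P_def)
    moreover have "(\<integral>x. (0 + c * indicator B x) * v x \<partial>completion M) =
        (\<integral>x. indicator A x *\<^sub>R c * v x \<partial>completion M)" for v
      by (rule Bochner_Integration.integral_cong) (auto simp: B(2) spM indicator_def)
    ultimately show ?case by (simp add: P_def)
  next
    case (add f g)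
    then show ?case
      using addP[of f g 1] by (simp add: integrable_completion)
  next
    case (lim f s)
    show ?case
      \<comment> \<open>The dominating function comes from the induction principle for integrable
        functions, which provides simple approximants bounded by twice the norm of the
        limit.\<close>
      by (rule approx[of s _ "\<lambda>x. 2 * \<bar>f x\<bar>"]) (use lim in \<open>auto simp: integrable_completion intro!: measurable_completion\<close>)
  qed
  then show ?thesis by (simp add: P_def)
qed

section \<open>Probability kernels and scales depending on the point\<close>

lemma integral_kernel_measurable:
  fixes g :: "'k \<Rightarrow> real"
  assumes "\<kappa> \<in> N \<rightarrow>\<^sub>M prob_algebra K" "g \<in> borel_measurable K"
  shows "(\<lambda>x. \<integral>z. g z \<partial>\<kappa> x) \<in> borel_measurable N"
  by (rule measurable_compose[OF measurable_prob_algebraD[OF assms(1)]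
        integral_measurable_subprob_algebra[OF assms(2)]])

lemma prob_kernelD:
  assumes "\<kappa> \<in> N \<rightarrow>\<^sub>M prob_algebra K" "x \<in> space N"
  shows "prob_space (\<kappa> x)" "sets (\<kappa> x) = sets K"
  using measurable_space[OF assms] by (auto simp: space_prob_algebra)

lemma (in prob_space) abs_integral_le:
  fixes g :: "'a \<Rightarrow> real"
  assumes g: "g \<in> borel_measurable M" and c: "\<And>z. z \<in> space M \<Longrightarrow> \<bar>g z\<bar> \<le> c"
  shows "integrable M g" "\<bar>\<integral>z. g z \<partial>M\<bar> \<le> c"
proof -
  show i: "integrable M g" by (rule integrable_const_bound[where B=c]) (use assms in auto)
  have "\<bar>\<integral>z. g z \<partial>M\<bar> \<le> (\<integral>z. \<bar>g z\<bar> \<partial>M)" using integral_norm_bound[of M g] by simp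
  also have "\<dots> \<le> (\<integral>z. c \<partial>M)"
    by (rule integral_mono) (use i c in auto)
  finally show "\<bar>\<integral>z. g z \<partial>M\<bar> \<le> c" by (simp add: prob_space)
qed

text \<open>If both scaled points lie outside the support ball, both values are 0. Otherwise one of
  them has norm at most \<open>R\<close>, which bounds \<open>norm z\<close> by
  \<open>R / min b c\<close>, and the Lipschitz estimate applies. The point is that the bound no
  longer depends on \<open>z\<close>.\<close>

lemma lipschitz_scaling_error:
  fixes f :: "'d::euclidean_space \<Rightarrow> real"
  assumes lip: "\<And>z z'. \<bar>f z - f z'\<bar> \<le> L * dist z z'" and supp: "\<And>z. R < norm z \<Longrightarrow> f z = 0"
    and "0 \<le> L" "0 < b" "0 < c" "0 \<le> R"
  shows "\<bar>f (b *\<^sub>R z) - f (c *\<^sub>R z)\<bar> \<le> L * R * \<bar>b - c\<bar> / min b c"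
proof (cases "R < norm (b *\<^sub>R z) \<and> R < norm (c *\<^sub>R z)")
  case True
  then show ?thesis using supp assms(3-6) by simp
next
  case False
  then have z: "norm z * min b c \<le> R"
    using assms(4,5) mult_left_mono[of "min b c" b "norm z"] mult_left_mono[of "min b c" c "norm z"]
    by (auto simp: mult.commute not_less)
  have "\<bar>f (b *\<^sub>R z) - f (c *\<^sub>R z)\<bar> \<le> L * (\<bar>b - c\<bar> * norm z)"
    using lip[of "b *\<^sub>R z" "c *\<^sub>R z"] by (simp add: dist_norm flip: scaleR_diff_left)
  also have "\<dots> \<le> L * (\<bar>b - c\<bar> * (R / min b c))"
    using z assms(3-5) by (intro mult_left_mono) (auto simp: pos_le_divide_eq)
  finally show ?thesis by (simp add: mult_ac)
qed

text \<open>For a simple scale the integral splits over finitely many level sets. On each of them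
  the scale is a constant \<open>c\<close>, so the hypothesis applies to the integrand
  \<open>f (c *\<^sub>R z)\<close>, with \<psi> times the indicator of the level set as integrable
  multiplier. A general scale \<open>b\<close> is approximated by simple ones, with an error uniform
  in \<open>z\<close> and hence in \<open>j\<close>.\<close>

lemma young_tendsto_scaled:
  fixes M :: "'n::euclidean_space measure" and v :: "nat \<Rightarrow> 'n \<Rightarrow> 'd::euclidean_space"
    and f :: "'d \<Rightarrow> real" and \<psi> :: "'n \<Rightarrow> real"
  assumes fin: "finite_measure M" and sM: "sets M = sets (restrict_space borel S)"
    and v[measurable]: "\<And>j. v j \<in> borel_measurable M"
    and nu[measurable]: "\<nu> \<in> completion M \<rightarrow>\<^sub>M prob_algebra borel"
    and conv: "\<And>(\<phi> :: 'n \<Rightarrow> real) (f :: 'd \<Rightarrow> real). continuous_on UNIV \<phi> \<Longrightarrow> continuous_on UNIV f \<Longrightarrow> (\<And>z. \<bar>f z\<bar> \<le> 1) \<Longrightarrow>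
      (\<lambda>j. \<integral>x. \<phi> x * f (v j x) \<partial>completion M) \<longlonglongrightarrow> (\<integral>x. \<phi> x * (\<integral>z. f z \<partial>\<nu> x) \<partial>completion M)"
    and b[measurable]: "b \<in> borel_measurable M" and bpos: "AE x in M. 0 < b x"
    and f1: "\<And>z. \<bar>f z\<bar> \<le> 1" and lip: "\<And>z z'. \<bar>f z - f z'\<bar> \<le> L * dist z z'"
    and supp: "\<And>z. R < norm z \<Longrightarrow> f z = 0" and "0 \<le> L" "0 \<le> R"
    and \<psi>: "integrable M \<psi>"
  shows "(\<lambda>j. \<integral>x. \<psi> x * f (b x *\<^sub>R v j x) \<partial>completion M) \<longlonglongrightarrow>
    (\<integral>x. \<psi> x * (\<integral>z. f (b x *\<^sub>R z) \<partial>\<nu> x) \<partial>completion M)"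
proof -
  note measurable_completion [measurable (raw)]
  interpret M: finite_measure M by fact
  let ?N = "completion M"
  have [measurable]: "\<psi> \<in> borel_measurable M" using \<psi> by simp
  have cf: "continuous_on UNIV f"
  proof (rule lipschitz_on_continuous_on[of L])
    show "L-lipschitz_on UNIV f"
      using lip \<open>0 \<le> L\<close> by (auto simp: lipschitz_on_def dist_real_def)
  qed
  have [measurable]: "f \<in> borel_measurable borel" by (rule borel_measurable_continuous_onI[OF cf])
  have \<psi>N: "integrable ?N \<psi>" using \<psi> by (simp add: integrable_completion)
  have prob: "prob_space (\<nu> x)" "sets (\<nu> x) = sets borel" if "x \<in> space M" for x
    using prob_kernelD[OF nu] that by auto
  have fcm: "(\<lambda>z. f (c *\<^sub>R z)) \<in> borel_measurable (\<nu> x)" if "x \<in> space M" for x c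
    unfolding measurable_cong_sets[OF prob(2)[OF that] refl] by measurable
  have fci: "integrable (\<nu> x) (\<lambda>z. f (c *\<^sub>R z))" if "x \<in> space M" for x c
    using prob_space.abs_integral_le(1)[OF prob(1)[OF that] fcm[OF that]] f1 by blast
  obtain B where sB: "\<And>k. simple_function M (B k)"
    and limB: "\<And>x. x \<in> space M \<Longrightarrow> (\<lambda>k. B k x) \<longlonglongrightarrow> b x"
    using borel_measurable_implies_sequence_metric[OF b, of 0] by blast
  have [measurable]: "B k \<in> borel_measurable M" for k
    using borel_measurable_simple_function[OF sB] .
  \<comment> \<open>Treating the scale as a separate parameter gives measurability in
    \<open>x\<close> for each fixed \<open>c\<close>. Variable scales follow from finite sums over
    the values of \<open>B k\<close>, and then from the limit in \<open>k\<close>.\<close>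
  define G where "G x c = (\<integral>z. f (c *\<^sub>R z) \<partial>\<nu> x)" for x c
  have Gm: "(\<lambda>x. G x c) \<in> borel_measurable ?N" for c
    unfolding G_def by (rule integral_kernel_measurable[OF nu]) simp
  have G1: "\<bar>G x c\<bar> \<le> 1" if "x \<in> space M" for x c
    unfolding G_def using prob_space.abs_integral_le(2)[OF prob(1)[OF that] fcm[OF that]] f1 by blast
  have Gcont: "(\<lambda>k. G x (B k x)) \<longlonglongrightarrow> G x (b x)" if "x \<in> space M" for x
  proof -
    interpret p: prob_space "\<nu> x" by (rule prob[OF that])
    show ?thesis unfolding G_def
    proof (rule integral_dominated_convergence[where w="\<lambda>_. 1"])
      show "AE z in \<nu> x. (\<lambda>k. f (B k x *\<^sub>R z)) \<longlonglongrightarrow> f (b x *\<^sub>R z)"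
        by (intro AE_I2 continuous_on_tendsto_compose[OF cf] tendsto_intros limB that) auto
    qed (use f1 fcm[OF that] in auto)
  qed
  have split: "g (B k x) = (\<Sum>c\<in>B k ` space M. indicator {x\<in>space M. B k x = c} x * g c)"
    if "x \<in> space M" for g :: "real \<Rightarrow> real" and k x
  proof -
    have "finite (B k ` space M)" by (rule simple_functionD(1)[OF sB])
    moreover have "indicator {x\<in>space M. B k x = c} x * g c = (if c = B k x then g c else 0)" for c
      using that by (auto simp: indicator_def)
    ultimately show ?thesis using that by (simp add: sum.delta)
  qed
  have GBm: "(\<lambda>x. G x (B k x)) \<in> borel_measurable ?N" for k
  proof -
    have m: "(\<lambda>x. \<Sum>c\<in>B k ` space M. indicator {x\<in>space M. B k x = c} x * G x c) \<in> borel_measurable ?N"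
      by (intro borel_measurable_sum borel_measurable_times Gm borel_measurable_indicator) simp
    show ?thesis
      by (rule measurable_cong[THEN iffD1, OF _ m]) (simp add: split[of _ "G _" k, symmetric])
  qed
  have Gbm: "(\<lambda>x. G x (b x)) \<in> borel_measurable ?N"
    by (rule borel_measurable_LIMSEQ_real[OF _ GBm]) (use Gcont in auto)
  have simple: "(\<lambda>j. \<integral>x. \<psi> x * f (B k x *\<^sub>R v j x) \<partial>?N) \<longlonglongrightarrow> (\<integral>x. \<psi> x * G x (B k x) \<partial>?N)" for k
  proof -
    let ?I = "\<lambda>c x. \<psi> x * indicator {x\<in>space M. B k x = c} x :: real"
    have Ii: "integrable M (?I c)" for c
      by (rule integrable_mult_bounded[OF \<psi>, where C=1]) (auto simp: indicator_def)
    \<comment> \<open>The integrand \<open>g\<close> is kept abstract because the decomposition is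
      applied both to \<open>f (c *\<^sub>R v j x)\<close> and to the limit
      \<open>G x c\<close>.\<close>
    have eq: "(\<integral>x. \<psi> x * g x (B k x) \<partial>?N) = (\<Sum>c\<in>B k ` space M. \<integral>x. ?I c x * g x c \<partial>?N)"
      if g: "\<And>c. (\<lambda>x. g x c) \<in> borel_measurable ?N" "\<And>c x. x \<in> space M \<Longrightarrow> \<bar>g x c\<bar> \<le> 1"
      for g :: "'n \<Rightarrow> real \<Rightarrow> real"
    proof -
      have "(\<integral>x. \<psi> x * g x (B k x) \<partial>?N) = (\<integral>x. (\<Sum>c\<in>B k ` space M. ?I c x * g x c) \<partial>?N)"
        by (rule Bochner_Integration.integral_cong[OF refl])
          (simp add: split[of _ "g _" k] sum_distrib_left mult.assoc)
      also have "\<dots> = (\<Sum>c\<in>B k ` space M. \<integral>x. ?I c x * g x c \<partial>?N)"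
        by (rule Bochner_Integration.integral_sum)
          (rule integrable_mult_bounded[where C=1], use Ii g in \<open>auto simp: integrable_completion\<close>)
      finally show ?thesis .
    qed
    have lim: "(\<lambda>j. \<integral>x. ?I c x * f (c *\<^sub>R v j x) \<partial>?N) \<longlonglongrightarrow> (\<integral>x. ?I c x * G x c \<partial>?N)" for c
    proof (rule integral_mult_tendsto_integrable[OF fin sM _ Gm _ _ _ Ii, where C=1])
      show "(\<lambda>x. f (c *\<^sub>R v j x)) \<in> borel_measurable ?N" for j
        by (rule measurable_completion) measurable
      show "(\<lambda>j. \<integral>x. \<phi> x * f (c *\<^sub>R v j x) \<partial>?N) \<longlonglongrightarrow> (\<integral>x. \<phi> x * G x c \<partial>?N)"
        if "continuous_on UNIV \<phi>" for \<phi>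
        unfolding G_def
        by (rule conv[OF that]) (auto intro!: continuous_on_compose2[OF cf] continuous_intros f1)
    qed (auto simp: f1 G1)
    show ?thesis
      by (subst (1 2) eq) (auto intro!: tendsto_sum lim Gm simp: f1 G1)
  qed
  \<comment> \<open>The value 2 is the trivial bound coming from
    \<open>\<bar>f z\<bar> \<le> 1\<close>. It caps the scaling estimate, which gives an integrable
    majorant, and it is the default where \<open>b x\<close> or \<open>B k x\<close> is not
    positive, a case that the scaling estimate does not cover.\<close>
  define d where "d k x = (if 0 < b x \<and> 0 < B k x then min 2 (L * R * \<bar>b x - B k x\<bar> / min (b x) (B k x)) else 2)" for k x
  have [measurable]: "d k \<in> borel_measurable M" for k unfolding d_def by measurable
  have d02: "0 \<le> d k x" "d k x \<le> 2" for k x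
    using \<open>0 \<le> L\<close> \<open>0 \<le> R\<close> by (auto simp: d_def)
  have fd: "\<bar>f (B k x *\<^sub>R z) - f (b x *\<^sub>R z)\<bar> \<le> d k x" for k x z
  proof -
    have "\<bar>f (B k x *\<^sub>R z) - f (b x *\<^sub>R z)\<bar> \<le> 2"
      using f1[of "B k x *\<^sub>R z"] f1[of "b x *\<^sub>R z"] by linarith
    then show ?thesis
      using lipschitz_scaling_error[of f L R "b x" "B k x" z, OF lip supp] \<open>0 \<le> L\<close> \<open>0 \<le> R\<close>
      by (auto simp: d_def abs_minus_commute)
  qed
  have Gd: "\<bar>G x (B k x) - G x (b x)\<bar> \<le> d k x" if "x \<in> space M" for k x
  proof -
    have "G x (B k x) - G x (b x) = (\<integral>z. f (B k x *\<^sub>R z) - f (b x *\<^sub>R z) \<partial>\<nu> x)"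
      unfolding G_def by (subst Bochner_Integration.integral_diff) (auto intro: fci that)
    then show ?thesis
      using prob_space.abs_integral_le(2)[OF prob(1)[OF that], of "\<lambda>z. f (B k x *\<^sub>R z) - f (b x *\<^sub>R z)" "d k x"]
        fd fcm[OF that] by auto
  qed
  have dlim: "(\<lambda>k. d k x) \<longlonglongrightarrow> 0" if x: "x \<in> space M" "0 < b x" for x
  proof -
    \<comment> \<open>The simple approximants need not be positive, but they become so at every
      point where their limit \<open>b x\<close> is.\<close>
    have ev: "eventually (\<lambda>k. 0 < B k x) sequentially"
      by (rule order_tendstoD(1)[OF limB[OF x(1)] x(2)])
    have "(\<lambda>k. L * R * \<bar>b x - B k x\<bar> / min (b x) (B k x)) \<longlonglongrightarrow> L * R * \<bar>b x - b x\<bar> / min (b x) (b x)"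
      using x by (intro tendsto_intros limB) auto
    then have "(\<lambda>k. L * R * \<bar>b x - B k x\<bar> / min (b x) (B k x)) \<longlonglongrightarrow> 0" by simp
    then show ?thesis
    proof (rule Lim_null_comparison[rotated])
      show "\<forall>\<^sub>F k in sequentially. norm (d k x) \<le> L * R * \<bar>b x - B k x\<bar> / min (b x) (B k x)"
        unfolding real_norm_def abs_of_nonneg[OF d02(1)]
        using ev by eventually_elim (use x in \<open>simp add: d_def\<close>)
    qed
  qed
  define e where "e k = (\<integral>x. \<bar>\<psi> x\<bar> * d k x \<partial>?N)" for k
  have "e \<longlonglongrightarrow> (\<integral>x. 0 \<partial>?N)"
    unfolding e_def
  proof (rule integral_dominated_convergence[where w="\<lambda>x. 2 * \<bar>\<psi> x\<bar>"])
    show "AE x in ?N. (\<lambda>k. \<bar>\<psi> x\<bar> * d k x) \<longlonglongrightarrow> 0"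
      unfolding AE_completion_iff using bpos AE_space
      by eventually_elim (intro tendsto_mult_right_zero dlim)
    show "AE x in ?N. norm (\<bar>\<psi> x\<bar> * d k x) \<le> 2 * \<bar>\<psi> x\<bar>" for k
      using d02[of k] by (intro AE_I2) (auto simp: abs_mult mult.commute[of 2] intro!: mult_left_mono)
  qed (use \<psi>N in auto)
  then have e0: "e \<longlonglongrightarrow> 0" by simp
  \<comment> \<open>One estimate serves twice: for the integrals along the sequence and for those of
    the limiting kernel.\<close>
  have err: "\<bar>(\<integral>x. \<psi> x * g x \<partial>?N) - (\<integral>x. \<psi> x * h x \<partial>?N)\<bar> \<le> e k"
    if [measurable]: "g \<in> borel_measurable ?N" "h \<in> borel_measurable ?N"
      and bd: "\<And>x. x \<in> space M \<Longrightarrow> \<bar>g x\<bar> \<le> 1" "\<And>x. x \<in> space M \<Longrightarrow> \<bar>h x\<bar> \<le> 1"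
        "\<And>x. x \<in> space M \<Longrightarrow> \<bar>g x - h x\<bar> \<le> d k x" for g h k
  proof -
    have i: "integrable ?N (\<lambda>x. \<psi> x * g x)" "integrable ?N (\<lambda>x. \<psi> x * h x)"
      by (rule integrable_mult_bounded[OF \<psi>N, where C=1]; use bd in simp)+
    have "(\<integral>x. \<psi> x * g x \<partial>?N) - (\<integral>x. \<psi> x * h x \<partial>?N) = (\<integral>x. \<psi> x * g x - \<psi> x * h x \<partial>?N)"
      by (rule Bochner_Integration.integral_diff[symmetric, OF i])
    also have "\<bar>\<dots>\<bar> \<le> (\<integral>x. \<bar>\<psi> x * g x - \<psi> x * h x\<bar> \<partial>?N)"
      using integral_norm_bound[of ?N "\<lambda>x. \<psi> x * g x - \<psi> x * h x"] by simp
    also have "\<dots> \<le> e k" unfolding e_def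
    proof (rule integral_mono)
      show "integrable ?N (\<lambda>x. \<bar>\<psi> x * g x - \<psi> x * h x\<bar>)"
        by (intro integrable_abs Bochner_Integration.integrable_diff i)
      show "integrable ?N (\<lambda>x. \<bar>\<psi> x\<bar> * d k x)"
        by (rule integrable_mult_bounded[where C=2]) (use \<psi>N d02 in auto)
      show "\<bar>\<psi> x * g x - \<psi> x * h x\<bar> \<le> \<bar>\<psi> x\<bar> * d k x" if "x \<in> space ?N" for x
        using bd(3)[of x] that by (auto simp: abs_mult mult_left_mono simp flip: right_diff_distrib)
    qed
    finally show ?thesis .
  qed
  have "(\<lambda>j. \<integral>x. \<psi> x * f (b x *\<^sub>R v j x) \<partial>?N) \<longlonglongrightarrow> (\<integral>x. \<psi> x * G x (b x) \<partial>?N)"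
  proof (rule tendsto_of_uniform_approx[OF _ _ _ e0])
    show "(\<lambda>j. \<integral>x. \<psi> x * f (B k x *\<^sub>R v j x) \<partial>?N) \<longlonglongrightarrow> (\<integral>x. \<psi> x * G x (B k x) \<partial>?N)" for k
      by (rule simple)
    show "\<bar>(\<integral>x. \<psi> x * f (B k x *\<^sub>R v j x) \<partial>?N) - (\<integral>x. \<psi> x * f (b x *\<^sub>R v j x) \<partial>?N)\<bar> \<le> e k" for k j
      by (rule err) (auto simp: f1 fd)
    show "\<bar>(\<integral>x. \<psi> x * G x (B k x) \<partial>?N) - (\<integral>x. \<psi> x * G x (b x) \<partial>?N)\<bar> \<le> e k" for k
      by (rule err) (auto simp: G1 Gd GBm Gbm)
  qed
  then show ?thesis by (simp add: G_def)
qed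

section \<open>Young measures on the sphere compactification\<close>

lemma subalgebra_subset_BC_ball:
  "closed_separable_subalgebra A \<Longrightarrow> A \<subseteq> mspace BC_ball"
  unfolding closed_separable_subalgebra_def using closedin_subset by fastforce

lemma space_bdry_borel: "space (bdry_borel X e) = bdry X e"
  by (auto simp: bdry_borel_def borel_of_def bdry_def space_measure_of_conv)

lemma continuous_map_borel_of_measurable:
  fixes f :: "'k \<Rightarrow> 'b::topological_space"
  assumes "continuous_map X euclidean f"
  shows "f \<in> borel_of X \<rightarrow>\<^sub>M borel"
proof (rule borel_measurableI)
  fix S :: "'b set" assume "open S"
  then have "openin X {x \<in> topspace X. f x \<in> S}"
    by (intro openin_continuous_map_preimage[OF assms]) simp
  moreover have "{U. openin X U} \<subseteq> Pow (topspace X)" using openin_subset by auto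
  moreover have "f -` S \<inter> space (borel_of X) = {x \<in> topspace X. f x \<in> S}"
    by (auto simp: borel_of_def space_measure_of_conv)
  ultimately show "f -` S \<inter> space (borel_of X) \<in> sets (borel_of X)"
    by (simp add: borel_of_def sets_measure_of)
qed

lemma K_proj_measurable:
  fixes A :: "('d::euclidean_space \<Rightarrow> real) set"
  assumes A: "A \<subseteq> mspace BC_ball" "C_cball \<subseteq> A"
  shows "K_proj A \<in> bdry_borel (K_top A) (eval_emb A) \<rightarrow>\<^sub>M restrict_space borel (sphere 0 1)"
proof (rule measurable_restrict_space2)
  show "K_proj A \<in> space (bdry_borel (K_top A) (eval_emb A)) \<rightarrow> sphere 0 1"
    using K_proj_bdry[OF A] by (auto simp: space_bdry_borel)
  have "continuous_map (K_top A) euclidean (K_proj A)"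
    using K_proj(1)[OF A] by (simp add: continuous_map_in_subtopology)
  then show "K_proj A \<in> bdry_borel (K_top A) (eval_emb A) \<rightarrow>\<^sub>M borel"
    unfolding bdry_borel_def
    by (intro continuous_map_borel_of_measurable continuous_map_from_subtopology)
qed

lemma prob_algebra_cong: "sets M = sets N \<Longrightarrow> prob_algebra M = prob_algebra N"
  by (simp add: prob_algebra_def cong: subprob_algebra_cong)

text \<open>A continuous extension \<open>F\<close> of the transform to the closed ball gives the
  extension \<open>F (K_proj A \<xi>)\<close> on the larger compactification. Every integrand
  admissible for the sphere is therefore admissible for \<open>A\<close>, and a change of variables
  moves the boundary integral to the pushed-forward measure.\<close>

lemma young_conv_sphere_of_alg:
  fixes A :: "('d::euclidean_space \<Rightarrow> real) set"
  assumes cA: "closed_separable_subalgebra A" and C: "C_cball \<subseteq> A"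
    and y: "young_conv_alg \<Omega> M A v \<nu> lam \<nu>i"
  shows "young_conv_sphere \<Omega> M v \<nu> lam (\<lambda>x. sphere_proj A (\<nu>i x))"
proof -
  note A = subalgebra_subset_BC_ball[OF cA] C
  have ki: "\<nu>i \<in> completion lam \<rightarrow>\<^sub>M prob_algebra (bdry_borel (K_top A) (eval_emb A))"
    using y by (simp add: young_conv_def)
  have pm: "(\<lambda>\<kappa>. distr \<kappa> (restrict_space borel (sphere 0 1)) (K_proj A)) \<in>
      prob_algebra (bdry_borel (K_top A) (eval_emb A)) \<rightarrow>\<^sub>M prob_algebra (restrict_space borel (sphere 0 1))"
    by (rule measurable_distr_prob_space[OF K_proj_measurable[OF A]])
  have "prob_algebra (bdry_borel (top_of_set (cball 0 1)) (\<lambda>z::'d. z)) = prob_algebra (restrict_space borel (sphere 0 1))"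
    by (rule prob_algebra_cong[OF sets_bdry_borel_sphere])
  then have m: "(\<lambda>x. sphere_proj A (\<nu>i x)) \<in> completion lam \<rightarrow>\<^sub>M
      prob_algebra (bdry_borel (top_of_set (cball 0 1)) (\<lambda>z. z))"
    using measurable_compose[OF ki pm] by (simp add: sphere_proj_def)
  have "(\<lambda>j. \<integral>x. \<phi> x * f (v j x) \<partial>M) \<longlonglongrightarrow>
      (\<integral>x. \<phi> x * (\<integral>z. f z \<partial>\<nu> x) \<partial>completion M) +
      (\<integral>x. \<phi> x * (\<integral>\<xi>. F \<xi> \<partial>sphere_proj A (\<nu>i x)) \<partial>completion lam)"
    if \<phi>: "continuous_on (closure \<Omega>) \<phi>" and f: "continuous_on UNIV f"
      and F: "T_extension (top_of_set (cball 0 1)) (\<lambda>z. z) f F" for \<phi> f F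
  proof -
    have cF: "continuous_on (cball 0 1) F" and Fe: "\<And>z. z \<in> ball 0 1 \<Longrightarrow> F z = T_trans f z"
      using F by (auto simp: T_extension_def)
    have mF: "F \<in> borel_measurable (restrict_space borel (sphere 0 1))"
      by (rule borel_measurable_continuous_on_restrict[OF continuous_on_subset[OF cF]]) auto
    have "T_extension (K_top A) (eval_emb A) f (\<lambda>\<xi>. F (K_proj A \<xi>))"
      unfolding T_extension_def
    proof
      have "continuous_map (top_of_set (cball 0 1)) euclideanreal F" using cF by simp
      from continuous_map_compose[OF K_proj(1)[OF A] this]
      show "continuous_map (K_top A) euclideanreal (\<lambda>\<xi>. F (K_proj A \<xi>))" by (simp add: o_def)
    qed (use K_proj(2)[OF A] Fe in auto)
    then have "(\<lambda>j. \<integral>x. \<phi> x * f (v j x) \<partial>M) \<longlonglongrightarrow>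
      (\<integral>x. \<phi> x * (\<integral>z. f z \<partial>\<nu> x) \<partial>completion M) +
      (\<integral>x. \<phi> x * (\<integral>\<xi>. F (K_proj A \<xi>) \<partial>\<nu>i x) \<partial>completion lam)"
      using y \<phi> f unfolding young_conv_def by blast
    moreover have "(\<integral>x. \<phi> x * (\<integral>\<xi>. F (K_proj A \<xi>) \<partial>\<nu>i x) \<partial>completion lam) =
        (\<integral>x. \<phi> x * (\<integral>\<xi>. F \<xi> \<partial>sphere_proj A (\<nu>i x)) \<partial>completion lam)"
    proof (rule Bochner_Integration.integral_cong[OF refl])
      fix x assume "x \<in> space (completion lam)"
      then have "sets (\<nu>i x) = sets (bdry_borel (K_top A) (eval_emb A))"
        using prob_kernelD(2)[OF ki] by blast
      then have "K_proj A \<in> \<nu>i x \<rightarrow>\<^sub>M restrict_space borel (sphere 0 1)"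
        using K_proj_measurable[OF A] measurable_cong_sets by blast
      from integral_distr[OF this mF]
      show "\<phi> x * (\<integral>\<xi>. F (K_proj A \<xi>) \<partial>\<nu>i x) = \<phi> x * (\<integral>\<xi>. F \<xi> \<partial>sphere_proj A (\<nu>i x))"
        by (simp add: sphere_proj_def)
    qed
    ultimately show ?thesis by simp
  qed
  then show ?thesis using y m unfolding young_conv_def by blast
qed

section \<open>Integrands with explicit recession functions\<close>

text \<open>The transform at \<open>y\<close> is at most \<open>C * (1 - norm y)\<close> in absolute
  value, so it tends to 0 at the sphere and extends there by 0.\<close>

lemma T_extension_bounded:
  fixes f :: "'d::euclidean_space \<Rightarrow> real"
  assumes f: "continuous_on UNIV f" and bd: "\<And>z. \<bar>f z\<bar> \<le> C"
  shows "T_extension (top_of_set (cball 0 1)) (\<lambda>z. z) f (\<lambda>z. if norm z < 1 then T_trans f z else 0)"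
    (is "T_extension _ _ _ ?F")
proof -
  have "continuous_on (ball 0 1) (T_trans f)"
    unfolding T_trans_def
    by (intro continuous_intros continuous_on_compose2[OF f]) auto
  then have "continuous_on (ball 0 1) ?F"
    by (rule continuous_on_eq) simp
  then have inner: "isCont ?F z" if "norm z < 1" for z
    using that by (simp add: continuous_on_eq_continuous_at)
  have outer: "(?F \<longlongrightarrow> 0) (at z within cball 0 1)" if z: "norm z = 1" for z
  proof (rule Lim_null_comparison)
    have "((\<lambda>y. C * (1 - norm y)) \<longlongrightarrow> C * (1 - norm z)) (at z within cball 0 1)"
      by (intro tendsto_intros)
    then show "((\<lambda>y. C * (1 - norm y)) \<longlongrightarrow> 0) (at z within cball 0 1)" using z by simp
    have "norm (?F y) \<le> C * (1 - norm y)" if "y \<in> cball 0 1" for y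
    proof (cases "norm y < 1")
      case True
      then show ?thesis
        using bd[of "y /\<^sub>R (1 - norm y)"] by (simp add: T_trans_def abs_mult mult.commute)
    qed (use that bd[of 0] in auto)
    then show "\<forall>\<^sub>F y in at z within cball 0 1. norm (?F y) \<le> C * (1 - norm y)"
      by (auto simp: eventually_at_filter)
  qed
  have "continuous_on (cball 0 1) ?F"
    unfolding continuous_on_def
  proof
    fix z :: 'd assume "z \<in> cball 0 1"
    then consider "norm z < 1" | "norm z = 1" by force
    then show "(?F \<longlongrightarrow> ?F z) (at z within cball 0 1)"
    proof cases
      case 1
      then show ?thesis using inner[OF 1] by (simp only: isCont_def) (rule tendsto_within_subset, auto)
    next
      case 2
      then show ?thesis using outer[OF 2] by simp
    qed
  qed
  then show ?thesis by (auto simp: T_extension_def)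
qed

text \<open>Inside the ball the factor \<open>1 - norm z\<close> is positive and cancels against the
  rescaling of the argument. Thus the transform of \<open>h\<close> is \<open>h\<close> itself, and
  \<open>h\<close> is already continuous up to the sphere.\<close>

lemma T_extension_homogeneous:
  fixes h :: "'d::euclidean_space \<Rightarrow> real"
  assumes "continuous_on UNIV h" "\<And>c z. 0 < c \<Longrightarrow> h (c *\<^sub>R z) = c * h z"
  shows "T_extension (top_of_set (cball 0 1)) (\<lambda>z. z) h h"
  using assms continuous_on_subset[OF assms(1)]
  by (auto simp: T_extension_def T_trans_def simp flip: assms(2))

text \<open>The degree-one homogeneous extension of a bump restricted to the unit sphere. These
  functions transport the countable determining family for measures on the sphere to admissible
  integrands. At the origin the factor \<open>norm z\<close> makes the value 0.\<close>

definition cone_bump :: "'d::euclidean_space set \<Rightarrow> nat \<Rightarrow> 'd \<Rightarrow> real" where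
  "cone_bump U k z = norm z * bump U k (z /\<^sub>R norm z)"

lemma cone_bump_homogeneous: "0 < c \<Longrightarrow> cone_bump U k (c *\<^sub>R z) = c * cone_bump U k z"
  by (simp add: cone_bump_def field_simps)

lemma cone_bump_sphere: "z \<in> sphere 0 1 \<Longrightarrow> cone_bump U k z = bump U k z"
  by (simp add: cone_bump_def)

text \<open>Away from the origin this is a composition of continuous maps; at the origin the
  direction has no limit, but the value is dominated by \<open>norm z\<close>.\<close>

lemma continuous_on_cone_bump: "continuous_on UNIV (cone_bump U k)"
proof -
  have "isCont (cone_bump U k) z" for z
  proof (cases "z = 0")
    case True
    have "(cone_bump U k \<longlongrightarrow> 0) (at 0)"
    proof (rule Lim_null_comparison)
      show "(norm \<longlongrightarrow> 0) (at (0 :: 'a))" by (rule tendsto_norm_zero[OF tendsto_ident_at])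
      show "\<forall>\<^sub>F y in at 0. norm (cone_bump U k y) \<le> norm y"
        by (intro always_eventually allI) (simp add: cone_bump_def abs_mult bump_range mult_left_le)
    qed
    then show ?thesis using True by (simp add: isCont_def cone_bump_def)
  next
    case False
    have "continuous_on (- {0}) (cone_bump U k)"
      unfolding cone_bump_def by (intro continuous_intros) auto
    then show ?thesis using False by (simp add: continuous_on_eq_continuous_at open_Compl)
  qed
  then show ?thesis by (simp add: continuous_on_eq_continuous_at)
qed

text \<open>Integrals against the Young kernels are measurable only for the completed measure. Both
  functions are replaced by versions measurable for \<open>M\<close> itself, which changes neither
  the integrals nor the almost-everywhere statement.\<close>

lemma AE_eq_of_integral_bump_eq_completion:
  fixes M :: "'n::euclidean_space measure" and u w :: "'n \<Rightarrow> real"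
  assumes sM: "sets M = sets (restrict_space borel S)"
    and int: "integrable (completion M) u" "integrable (completion M) w"
    and eq: "\<And>U k. U \<in> rational_boxes_set \<Longrightarrow>
      (\<integral>x. bump U k x * u x \<partial>completion M) = (\<integral>x. bump U k x * w x \<partial>completion M)"
  shows "AE x in M. u x = w x"
proof -
  have ver: "\<exists>u'. integrable M u' \<and> (AE x in M. u x = u' x) \<and>
      (\<forall>U k. (\<integral>x. bump U k x * u x \<partial>completion M) = (\<integral>x. bump U k x * u' x \<partial>M))"
    if u: "integrable (completion M) u" for u :: "'n \<Rightarrow> real"
  proof -
    have [measurable]: "u \<in> borel_measurable (completion M)" using u by simp
    obtain u' where [measurable]: "u' \<in> borel_measurable M" and ae: "AE x in M. u x = u' x"
      using completion_ex_borel_measurable_real[of u M] by auto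
    have ae': "AE x in completion M. u x = u' x" using ae by (simp add: AE_completion_iff)
    have "integrable (completion M) u'"
      by (rule integrable_cong_AE_imp[OF u _ ae']) (rule measurable_completion, measurable)
    then have "integrable M u'" by (simp add: integrable_completion)
    moreover have "(\<integral>x. bump U k x * u x \<partial>completion M) = (\<integral>x. bump U k x * u' x \<partial>M)" for U k
    proof -
      have [measurable]: "bump U k \<in> borel_measurable M"
        by (rule measurable_of_borel_restrict[OF borel_measurable_bump sM])
      have bu: "(\<lambda>x. bump U k x * u' x) \<in> borel_measurable M" by measurable
      have "(\<integral>x. bump U k x * u x \<partial>completion M) = (\<integral>x. bump U k x * u' x \<partial>completion M)"
      proof (rule integral_cong_AE[OF _ measurable_completion[OF bu]])
        show "(\<lambda>x. bump U k x * u x) \<in> borel_measurable (completion M)"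
          by (intro borel_measurable_times measurable_completion[of "bump U k"]) measurable
        show "AE x in completion M. bump U k x * u x = bump U k x * u' x"
          using ae' by eventually_elim simp
      qed
      also have "\<dots> = (\<integral>x. bump U k x * u' x \<partial>M)" by (rule integral_completion[OF bu])
      finally show ?thesis .
    qed
    ultimately show ?thesis using ae by blast
  qed
  obtain u' where u': "integrable M u'" "AE x in M. u x = u' x"
    "\<And>U k. (\<integral>x. bump U k x * u x \<partial>completion M) = (\<integral>x. bump U k x * u' x \<partial>M)"
    using ver[OF int(1)] by blast
  obtain w' where w': "integrable M w'" "AE x in M. w x = w' x"
    "\<And>U k. (\<integral>x. bump U k x * w x \<partial>completion M) = (\<integral>x. bump U k x * w' x \<partial>M)"
    using ver[OF int(2)] by blast
  have "AE x in M. u' x = w' x"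
    using eq u'(3) w'(3) by (intro AE_eq_of_integral_bump_eq[OF sM u'(1) w'(1)]) simp
  with u'(2) w'(2) show ?thesis by eventually_elim simp
qed

lemma young_conv_sphereD:
  fixes v :: "nat \<Rightarrow> 'n::euclidean_space \<Rightarrow> 'd::euclidean_space"
  assumes "young_conv_sphere \<Omega> M v \<nu> lam \<kappa>"
  shows "\<kappa> \<in> completion lam \<rightarrow>\<^sub>M prob_algebra (restrict_space borel (sphere 0 1))"
    "\<nu> \<in> completion M \<rightarrow>\<^sub>M prob_algebra borel"
    "finite_measure lam" "sets lam = sets (restrict_space borel (closure \<Omega>))"
    "v j \<in> borel_measurable M"
proof -
  have "\<kappa> \<in> completion lam \<rightarrow>\<^sub>M prob_algebra (bdry_borel (top_of_set (cball 0 1)) (\<lambda>z::'d. z))"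
    using assms by (simp add: young_conv_def)
  then show "\<kappa> \<in> completion lam \<rightarrow>\<^sub>M prob_algebra (restrict_space borel (sphere 0 1))"
    by (simp only: prob_algebra_cong[OF sets_bdry_borel_sphere])
  have "integrable M (v j)" using assms by (simp add: young_conv_def L1_bounded_def)
  then show "v j \<in> borel_measurable M" by simp
qed (use assms in \<open>simp_all add: young_conv_def\<close>)

text \<open>The extension of the transform vanishes on the sphere, where the measures of the
  concentration kernel live, so only the oscillation part of the limit remains.\<close>

lemma young_conv_sphere_bounded:
  fixes f :: "'d::euclidean_space \<Rightarrow> real"
  assumes y: "young_conv_sphere \<Omega> M v \<nu> lam \<kappa>"
    and "continuous_on UNIV \<phi>" and f: "continuous_on UNIV f" "\<And>z. \<bar>f z\<bar> \<le> C"
  shows "(\<lambda>j. \<integral>x. \<phi> x * f (v j x) \<partial>M) \<longlonglongrightarrow> (\<integral>x. \<phi> x * (\<integral>z. f z \<partial>\<nu> x) \<partial>completion M)"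
proof -
  let ?F = "\<lambda>z. if norm z < 1 then T_trans f z else 0"
  have "(\<lambda>j. \<integral>x. \<phi> x * f (v j x) \<partial>M) \<longlonglongrightarrow>
      (\<integral>x. \<phi> x * (\<integral>z. f z \<partial>\<nu> x) \<partial>completion M) + (\<integral>x. \<phi> x * (\<integral>\<xi>. ?F \<xi> \<partial>\<kappa> x) \<partial>completion lam)"
    using y T_extension_bounded[OF f] f(1) continuous_on_subset[OF assms(2) subset_UNIV]
    unfolding young_conv_def by blast
  moreover have "(\<integral>x. \<phi> x * (\<integral>\<xi>. ?F \<xi> \<partial>\<kappa> x) \<partial>completion lam) = (\<integral>x. 0 \<partial>completion lam)"
  proof (rule Bochner_Integration.integral_cong[OF refl])
    fix x assume "x \<in> space (completion lam)"
    then have "space (\<kappa> x) = sphere 0 1"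
      using sets_eq_imp_space_eq[OF prob_kernelD(2)[OF young_conv_sphereD(1)[OF y]]]
      by (simp add: space_restrict_space)
    then have "(\<integral>\<xi>. ?F \<xi> \<partial>\<kappa> x) = (\<integral>\<xi>. 0 \<partial>\<kappa> x)"
      by (intro Bochner_Integration.integral_cong) auto
    then show "\<phi> x * (\<integral>\<xi>. ?F \<xi> \<partial>\<kappa> x) = 0" by simp
  qed
  ultimately show ?thesis by simp
qed

lemma young_conv_sphere_homogeneous:
  fixes h :: "'d::euclidean_space \<Rightarrow> real"
  assumes y: "young_conv_sphere \<Omega> M v \<nu> lam \<kappa>"
    and "continuous_on UNIV \<phi>" and h: "continuous_on UNIV h" "\<And>c z. 0 < c \<Longrightarrow> h (c *\<^sub>R z) = c * h z"
  shows "(\<lambda>j. \<integral>x. \<phi> x * h (v j x) \<partial>M) \<longlonglongrightarrow>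
    (\<integral>x. \<phi> x * (\<integral>z. h z \<partial>\<nu> x) \<partial>completion M) + (\<integral>x. \<phi> x * (\<integral>z. h z \<partial>\<kappa> x) \<partial>completion lam)"
  using y T_extension_homogeneous[OF h] h(1) continuous_on_subset[OF assms(2) subset_UNIV]
  unfolding young_conv_def by blast

section \<open>Comparison of the two limits under rescaling\<close>

text \<open>The conclusions build on each other. Equality of the oscillation parts is what isolates
  the concentration parts, and equality of \<open>lam1\<close> and \<open>lam2\<close> is what
  allows the two sphere-valued kernels to be compared over one measure.\<close>

lemma young_conv_sphere_rescaled_unique:
  fixes \<Omega> :: "'n::euclidean_space set" and v :: "nat \<Rightarrow> 'n \<Rightarrow> 'd::euclidean_space"
  assumes fin: "finite_measure M" and sM: "sets M = sets (restrict_space borel \<Omega>)"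
    and a: "integrable M a" and apos: "AE x in M. 0 < a x"
    and y1: "young_conv_sphere \<Omega> M v \<nu> lam1 \<kappa>1"
    and y2: "young_conv_sphere \<Omega> (density M (\<lambda>x. ennreal (a x))) (\<lambda>j x. v j x /\<^sub>R a x) \<eta> lam2 \<kappa>2"
  shows "AE x in M. \<eta> x = distr (\<nu> x) borel (\<lambda>z. z /\<^sub>R a x)"
    and "lam1 = lam2"
    and "AE x in lam1. \<kappa>1 x = \<kappa>2 x"
proof -
  let ?C = "completion M" and ?N = "density M (\<lambda>x. ennreal (a x))"
  have am[measurable]: "a \<in> borel_measurable M" using a by simp
  have aC: "integrable ?C a" using a by (simp add: integrable_completion)
  have aposC: "AE x in ?C. 0 < a x" using apos by (simp add: AE_completion_iff)
  have a0: "AE x in ?C. 0 \<le> a x" using aposC by eventually_elim simp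
  \<comment> \<open>Since \<open>a\<close> is positive almost everywhere, weighting by
    \<open>a\<close> preserves the null sets and so commutes with completion. All integrals over the
    weighted measure can then be written over \<open>?C\<close> with a factor
    \<open>a x\<close>.\<close>
  have cN: "completion ?N = density ?C (\<lambda>x. ennreal (a x))"
    by (rule completion_density_eq) (use apos in auto)
  have vm[measurable]: "v j \<in> borel_measurable M" for j by (rule young_conv_sphereD(5)[OF y1])
  have num[measurable]: "\<nu> \<in> ?C \<rightarrow>\<^sub>M prob_algebra borel" by (rule young_conv_sphereD(2)[OF y1])
  have etam[measurable]: "\<eta> \<in> ?C \<rightarrow>\<^sub>M prob_algebra borel"
    using young_conv_sphereD(2)[OF y2] unfolding cN by simp
  have bm: "f \<in> borel_measurable M" if "continuous_on UNIV f" for f :: "'n \<Rightarrow> real"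
    by (rule measurable_of_borel_restrict[OF borel_measurable_continuous_onI[OF that] sM])
  have intC: "integral\<^sup>L (completion ?N) f = (\<integral>x. a x * f x \<partial>?C)" if "f \<in> borel_measurable ?C" for f :: "'n \<Rightarrow> real"
    unfolding cN using integral_density[OF that measurable_completion[OF am] a0] by simp
  have intN: "integral\<^sup>L ?N f = (\<integral>x. a x * f x \<partial>?C)" if [measurable]: "f \<in> borel_measurable M" for f :: "'n \<Rightarrow> real"
  proof -
    have "integral\<^sup>L ?N f = integral\<^sup>L (completion ?N) f"
      by (rule integral_completion[symmetric]) simp
    also have "\<dots> = (\<integral>x. a x * f x \<partial>?C)" by (rule intC[OF measurable_completion[OF that]])
    finally show ?thesis .
  qed
  \<comment> \<open>The candidate for \<open>\<eta> x\<close>. It is first shown to be a kernel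
    measurable for the completion, so that both can be tested against bumps.\<close>
  define \<rho> where "\<rho> x = distr (\<nu> x) borel (\<lambda>z. z /\<^sub>R a x)" for x
  have rm[measurable]: "\<rho> \<in> ?C \<rightarrow>\<^sub>M prob_algebra borel"
    unfolding \<rho>_def[abs_def]
  proof (rule measurable_distr_prob_space2[OF num])
    have "(\<lambda>p. a (fst p)) \<in> borel_measurable (?C \<Otimes>\<^sub>M (borel :: 'd measure))"
      by (rule measurable_compose[OF measurable_fst measurable_completion[OF am]])
    then show "(\<lambda>(x, z :: 'd). z /\<^sub>R a x) \<in> borel_measurable (?C \<Otimes>\<^sub>M borel)"
      unfolding case_prod_beta
      by (intro borel_measurable_scaleR borel_measurable_inverse measurable_snd)
  qed
  have rint: "(\<integral>z. f z \<partial>\<rho> x) = (\<integral>z. f (z /\<^sub>R a x) \<partial>\<nu> x)"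
    if "x \<in> space M" "f \<in> borel_measurable borel" for f :: "'d \<Rightarrow> real" and x
  proof -
    have "sets (\<nu> x) = sets borel" using prob_kernelD(2)[OF num] that by simp
    then have "(\<lambda>z. z /\<^sub>R a x) \<in> \<nu> x \<rightarrow>\<^sub>M borel"
      by (subst measurable_cong_sets[OF _ refl])
        (auto intro!: borel_measurable_continuous_onI continuous_intros)
    then show ?thesis unfolding \<rho>_def using that(2) by (rule integral_distr)
  qed
  have bi: "\<bar>\<integral>z. bump U k z \<partial>\<kappa> x\<bar> \<le> 1" if "\<kappa> \<in> ?C \<rightarrow>\<^sub>M prob_algebra borel" "x \<in> space M" for \<kappa> and U :: "'d set" and k x
  proof (rule prob_space.abs_integral_le(2))
    show "prob_space (\<kappa> x)" using prob_kernelD(1)[OF that(1)] that(2) by simp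
    have "sets (\<kappa> x) = sets borel" using prob_kernelD(2)[OF that(1)] that(2) by simp
    then show "bump U k \<in> borel_measurable (\<kappa> x)"
      by (subst measurable_cong_sets[OF _ refl]) (auto intro: borel_measurable_bump)
  qed (rule bump_range)
  have "AE x in M. (\<integral>z. bump U k z \<partial>\<rho> x) = (\<integral>z. bump U k z \<partial>\<eta> x)"
    if U: "U \<in> rational_boxes_set" for U :: "'d set" and k
  proof -
    obtain R where R: "0 \<le> R" "\<And>z. z \<in> U \<Longrightarrow> norm z \<le> R"
      using rational_boxes_set_D(2)[OF U] unfolding bounded_iff
      by (metis norm_ge_zero order_trans linear)
    have rG: "(\<lambda>x. \<integral>z. bump U k z \<partial>\<rho> x) \<in> borel_measurable ?C"
      and eG: "(\<lambda>x. \<integral>z. bump U k z \<partial>\<eta> x) \<in> borel_measurable ?C"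
      by (rule integral_kernel_measurable[OF rm borel_measurable_bump],
          rule integral_kernel_measurable[OF etam borel_measurable_bump])
    \<comment> \<open>Both sides are limits of the same sequence \<open>?X\<close>: one is computed
      from \<nu> with the variable scale \<open>inverse (a x)\<close>, the other from \<eta> over
      the weighted measure. The bound on \<phi> keeps \<open>a x * \<phi> x\<close>
      integrable.\<close>
    have test: "(\<integral>x. \<phi> x * (a x * (\<integral>z. bump U k z \<partial>\<rho> x)) \<partial>?C) = (\<integral>x. \<phi> x * (a x * (\<integral>z. bump U k z \<partial>\<eta> x)) \<partial>?C)"
      if c: "continuous_on UNIV \<phi>" and b: "\<And>x. \<bar>\<phi> x\<bar> \<le> 1" for \<phi> :: "'n \<Rightarrow> real"
    proof (rule LIMSEQ_unique)
      have [measurable]: "\<phi> \<in> borel_measurable M" by (rule bm[OF c])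
      let ?X = "\<lambda>j. \<integral>x. (a x * \<phi> x) * bump U k (inverse (a x) *\<^sub>R v j x) \<partial>?C"
      have "?X \<longlonglongrightarrow> (\<integral>x. (a x * \<phi> x) * (\<integral>z. bump U k (inverse (a x) *\<^sub>R z) \<partial>\<nu> x) \<partial>?C)"
      \<comment> \<open>The bump with index \<open>k\<close> has Lipschitz constant
        \<open>k\<close>, and \<open>R\<close> bounds the box outside of which it vanishes.\<close>
      proof (rule young_tendsto_scaled[OF fin sM vm num, where L=k and R=R])
        show "(\<lambda>j. \<integral>x. \<phi> x * f (v j x) \<partial>?C) \<longlonglongrightarrow> (\<integral>x. \<phi> x * (\<integral>z. f z \<partial>\<nu> x) \<partial>?C)"
          if "continuous_on UNIV \<phi>" "continuous_on UNIV f" "\<And>z. \<bar>f z\<bar> \<le> 1"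
          for \<phi> :: "'n \<Rightarrow> real" and f :: "'d \<Rightarrow> real"
        proof -
          have [measurable]: "\<phi> \<in> borel_measurable M" "f \<in> borel_measurable borel"
            by (rule bm[OF that(1)], rule borel_measurable_continuous_onI[OF that(2)])
          have "(\<integral>x. \<phi> x * f (v j x) \<partial>?C) = (\<integral>x. \<phi> x * f (v j x) \<partial>M)" for j
            by (rule integral_completion) measurable
          then show ?thesis
            using young_conv_sphere_bounded[OF y1 that] by simp
        qed
        show "AE x in M. 0 < inverse (a x)" using apos by simp
        show "integrable M (\<lambda>x. a x * \<phi> x)" by (rule integrable_mult_bounded[OF a, where C=1]) (auto intro: b)
        show "bump U k z = 0" if "R < norm z" for z
          by (rule bump_outside) (use R(2)[of z] that in auto)
      qed (use R(1) in \<open>auto simp: bump_range bump_lipschitz\<close>)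
      also have "(\<integral>x. (a x * \<phi> x) * (\<integral>z. bump U k (inverse (a x) *\<^sub>R z) \<partial>\<nu> x) \<partial>?C) =
          (\<integral>x. \<phi> x * (a x * (\<integral>z. bump U k z \<partial>\<rho> x)) \<partial>?C)"
        by (rule Bochner_Integration.integral_cong[OF refl]) (simp add: rint)
      finally show "?X \<longlonglongrightarrow> (\<integral>x. \<phi> x * (a x * (\<integral>z. bump U k z \<partial>\<rho> x)) \<partial>?C)" .
      have "(\<lambda>j. \<integral>x. \<phi> x * bump U k (v j x /\<^sub>R a x) \<partial>?N) \<longlonglongrightarrow>
          (\<integral>x. \<phi> x * (\<integral>z. bump U k z \<partial>\<eta> x) \<partial>completion ?N)"
        by (rule young_conv_sphere_bounded[OF y2 c, where C=1])
          (auto intro: continuous_intros simp: bump_range)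
      also have "(\<integral>x. \<phi> x * (\<integral>z. bump U k z \<partial>\<eta> x) \<partial>completion ?N) =
          (\<integral>x. \<phi> x * (a x * (\<integral>z. bump U k z \<partial>\<eta> x)) \<partial>?C)"
        unfolding intC[OF borel_measurable_times[OF measurable_completion[OF bm[OF c]] eG]]
        by (simp only: mult.left_commute)
      also have "(\<lambda>j. \<integral>x. \<phi> x * bump U k (v j x /\<^sub>R a x) \<partial>?N) = ?X"
      proof
        show "(\<integral>x. \<phi> x * bump U k (v j x /\<^sub>R a x) \<partial>?N) = ?X j" for j
          unfolding mult.assoc by (rule intN) measurable
      qed
      finally show "?X \<longlonglongrightarrow> (\<integral>x. \<phi> x * (a x * (\<integral>z. bump U k z \<partial>\<eta> x)) \<partial>?C)" .
    qed
    have "AE x in M. a x * (\<integral>z. bump U k z \<partial>\<rho> x) = a x * (\<integral>z. bump U k z \<partial>\<eta> x)"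
    proof (rule AE_eq_of_integral_bump_eq_completion[OF sM])
      show "integrable ?C (\<lambda>x. a x * (\<integral>z. bump U k z \<partial>\<rho> x))"
        by (rule integrable_mult_bounded[OF aC rG, where C=1]) (rule bi[OF rm], simp)
      show "integrable ?C (\<lambda>x. a x * (\<integral>z. bump U k z \<partial>\<eta> x))"
        by (rule integrable_mult_bounded[OF aC eG, where C=1]) (rule bi[OF etam], simp)
    qed (rule test[OF continuous_on_bump[OF continuous_on_id] bump_range(3)])
    then show ?thesis using apos by eventually_elim simp
  qed
  \<comment> \<open>Only countably many pairs of a box and an index occur, so a single null set
    serves for all of them, and outside it the two probability measures have the same bump
    integrals.\<close>
  then have "AE x in M. \<forall>U\<in>rational_boxes_set. \<forall>k. (\<integral>z. bump U k z \<partial>\<rho> x) = (\<integral>z. bump U k z \<partial>\<eta> x)"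
    by (intro AE_ball_countable'[OF _ countable_rational_boxes_set]) (simp add: AE_all_countable)
  then have eta: "AE x in M. \<eta> x = \<rho> x"
    using AE_space
  proof eventually_elim
    case (elim x)
    have x: "x \<in> space ?C" using elim(2) by simp
    show ?case
      using prob_kernelD[OF etam x] prob_kernelD[OF rm x] elim(1)
      by (intro finite_measure_eqI_bump[where S=UNIV]) (auto simp: prob_space.finite_measure)
  qed
  then show "AE x in M. \<eta> x = distr (\<nu> x) borel (\<lambda>z. z /\<^sub>R a x)" by (simp add: \<rho>_def)

  note k1 = young_conv_sphereD(1)[OF y1] and k2 = young_conv_sphereD(1)[OF y2]
  note s1 = young_conv_sphereD(4)[OF y1] and s2 = young_conv_sphereD(4)[OF y2]
  have sph: "(\<integral>\<xi>. g \<xi> \<partial>\<kappa> x) = (\<integral>\<xi>. h \<xi> \<partial>\<kappa> x)"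
    if "\<kappa> \<in> completion lam \<rightarrow>\<^sub>M prob_algebra (restrict_space borel (sphere 0 1))" "x \<in> space lam"
      "\<And>\<xi>. norm \<xi> = 1 \<Longrightarrow> g \<xi> = h \<xi>" for \<kappa> lam x and g h :: "'d \<Rightarrow> real"
    using that(3) sets_eq_imp_space_eq[OF prob_kernelD(2)[OF that(1), of x]] that(2)
    by (intro Bochner_Integration.integral_cong) (auto simp: space_restrict_space)
  \<comment> \<open>By homogeneity the factor \<open>a x\<close> cancels against the division inside
    \<open>h\<close>. This identifies the two sequences of integrals, and, by the relation between
    \<eta> and \<nu> just proved, also the oscillation parts of their limits. Uniqueness of limits
    leaves the concentration parts equal.\<close>
  have conc: "(\<integral>x. \<phi> x * (\<integral>\<xi>. h \<xi> \<partial>\<kappa>1 x) \<partial>completion lam1) = (\<integral>x. \<phi> x * (\<integral>\<xi>. h \<xi> \<partial>\<kappa>2 x) \<partial>completion lam2)"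
    if c: "continuous_on UNIV \<phi>" and h: "continuous_on UNIV h" "\<And>c z. 0 < c \<Longrightarrow> h (c *\<^sub>R z) = c * h z"
    for \<phi> :: "'n \<Rightarrow> real" and h :: "'d \<Rightarrow> real"
  proof -
    have [measurable]: "\<phi> \<in> borel_measurable M" by (rule bm[OF c])
    have hm[measurable]: "h \<in> borel_measurable borel" by (rule borel_measurable_continuous_onI[OF h(1)])
    have "(\<integral>x. \<phi> x * h (v j x /\<^sub>R a x) \<partial>?N) = (\<integral>x. \<phi> x * h (v j x) \<partial>M)" for j
    proof -
      have "(\<integral>x. \<phi> x * h (v j x /\<^sub>R a x) \<partial>?N) = (\<integral>x. a x * (\<phi> x * h (v j x /\<^sub>R a x)) \<partial>?C)"
        by (rule intN) measurable
      also have "\<dots> = (\<integral>x. \<phi> x * h (v j x) \<partial>?C)"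
      proof (rule integral_cong_AE)
        show "AE x in ?C. a x * (\<phi> x * h (v j x /\<^sub>R a x)) = \<phi> x * h (v j x)"
          using aposC by eventually_elim (simp add: h(2))
      qed (rule measurable_completion, measurable)+
      also have "\<dots> = (\<integral>x. \<phi> x * h (v j x) \<partial>M)"
        by (rule integral_completion) measurable
      finally show ?thesis .
    qed
    moreover have "(\<integral>x. \<phi> x * (\<integral>z. h z \<partial>\<eta> x) \<partial>completion ?N) = (\<integral>x. \<phi> x * (\<integral>z. h z \<partial>\<nu> x) \<partial>?C)"
    proof -
      have hm\<eta>: "(\<lambda>x. \<phi> x * (\<integral>z. h z \<partial>\<eta> x)) \<in> borel_measurable ?C"
        and hm\<nu>: "(\<lambda>x. \<phi> x * (\<integral>z. h z \<partial>\<nu> x)) \<in> borel_measurable ?C"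
        by (intro borel_measurable_times measurable_completion[OF bm[OF c]]
            integral_kernel_measurable[OF etam hm] integral_kernel_measurable[OF num hm])+
      have "(\<integral>x. \<phi> x * (\<integral>z. h z \<partial>\<eta> x) \<partial>completion ?N) = (\<integral>x. a x * (\<phi> x * (\<integral>z. h z \<partial>\<eta> x)) \<partial>?C)"
        by (rule intC[OF hm\<eta>])
      also have "\<dots> = (\<integral>x. \<phi> x * (\<integral>z. h z \<partial>\<nu> x) \<partial>?C)"
      proof (rule integral_cong_AE[OF borel_measurable_times[OF measurable_completion[OF am] hm\<eta>] hm\<nu>])
        show "AE x in ?C. a x * (\<phi> x * (\<integral>z. h z \<partial>\<eta> x)) = \<phi> x * (\<integral>z. h z \<partial>\<nu> x)"
          unfolding AE_completion_iff using apos eta AE_space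
          by eventually_elim (simp add: rint h(2))
      qed
      finally show ?thesis .
    qed
    ultimately have "(\<lambda>j. \<integral>x. \<phi> x * h (v j x) \<partial>M) \<longlonglongrightarrow>
        (\<integral>x. \<phi> x * (\<integral>z. h z \<partial>\<nu> x) \<partial>?C) + (\<integral>x. \<phi> x * (\<integral>\<xi>. h \<xi> \<partial>\<kappa>2 x) \<partial>completion lam2)"
      using young_conv_sphere_homogeneous[OF y2 c h] by simp
    from LIMSEQ_unique[OF young_conv_sphere_homogeneous[OF y1 c h] this] show ?thesis by simp
  qed
  \<comment> \<open>The norm is 1 on the sphere and the kernel consists of probability measures, so
    testing with the norm recovers integrals against \<open>lam\<close> alone.\<close>
  have mass: "(\<integral>x. bump V m x * (\<integral>\<xi>. norm \<xi> \<partial>\<kappa> x) \<partial>completion lam) = (\<integral>x. bump V m x \<partial>lam)"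
    if k: "\<kappa> \<in> completion lam \<rightarrow>\<^sub>M prob_algebra (restrict_space borel (sphere (0::'d) 1))"
      and s: "sets lam = sets (restrict_space borel (closure \<Omega>))" for \<kappa> lam V m
  proof -
    have "(\<integral>x. bump V m x * (\<integral>\<xi>. norm \<xi> \<partial>\<kappa> x) \<partial>completion lam) = (\<integral>x. bump V m x \<partial>completion lam)"
    proof (rule Bochner_Integration.integral_cong[OF refl])
      fix x assume x: "x \<in> space (completion lam)"
      interpret p: prob_space "\<kappa> x" by (rule prob_kernelD(1)[OF k x])
      have "(\<integral>\<xi>. norm \<xi> \<partial>\<kappa> x) = (\<integral>\<xi>. 1 \<partial>\<kappa> x)" using x by (intro sph[OF k]) simp_all
      then show "bump V m x * (\<integral>\<xi>. norm \<xi> \<partial>\<kappa> x) = bump V m x" by (simp add: p.prob_space)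
    qed
    also have "\<dots> = (\<integral>x. bump V m x \<partial>lam)"
      by (rule integral_completion[OF measurable_of_borel_restrict[OF borel_measurable_bump s]])
    finally show ?thesis .
  qed
  show lam: "lam1 = lam2"
  proof (rule finite_measure_eqI_bump[OF young_conv_sphereD(3)[OF y1] young_conv_sphereD(3)[OF y2] s1 s2])
    show "(\<integral>x. bump V m x \<partial>lam1) = (\<integral>x. bump V m x \<partial>lam2)" for V :: "'n set" and m
      using conc[of "bump V m" norm] unfolding mass[OF k1 s1] mass[OF k2 s2]
      by (simp add: continuous_intros)
  qed
  interpret L: finite_measure lam1 by (rule young_conv_sphereD(3)[OF y1])
  have one: "integrable (completion lam1) (\<lambda>_. 1 :: real)"
    by (simp add: integrable_completion)
  have k2': "\<kappa>2 \<in> completion lam1 \<rightarrow>\<^sub>M prob_algebra (restrict_space borel (sphere 0 1))"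
    using k2 lam by simp
  have bs: "bump U k \<in> borel_measurable (restrict_space borel (sphere (0::'d) 1))" for U k
    by (rule measurable_restrict_space1[OF borel_measurable_bump])
  have ibs: "integrable (completion lam1) (\<lambda>x. \<integral>\<xi>. bump U k \<xi> \<partial>\<kappa> x)"
    if k: "\<kappa> \<in> completion lam1 \<rightarrow>\<^sub>M prob_algebra (restrict_space borel (sphere (0::'d) 1))" for \<kappa> U k
  proof -
    have "\<bar>\<integral>\<xi>. bump U k \<xi> \<partial>\<kappa> x\<bar> \<le> 1" if x: "x \<in> space (completion lam1)" for x
    proof (rule prob_space.abs_integral_le(2)[OF prob_kernelD(1)[OF k x]])
      show "bump U k \<in> borel_measurable (\<kappa> x)"
        using bs by (subst measurable_cong_sets[OF prob_kernelD(2)[OF k x] refl])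
    qed (rule bump_range)
    from integrable_mult_bounded[OF one integral_kernel_measurable[OF k bs] this] show ?thesis by simp
  qed
  have "AE x in lam1. (\<integral>\<xi>. bump U k \<xi> \<partial>\<kappa>1 x) = (\<integral>\<xi>. bump U k \<xi> \<partial>\<kappa>2 x)" for U k
  proof (rule AE_eq_of_integral_bump_eq_completion[OF s1 ibs[OF k1] ibs[OF k2']])
    fix V :: "'n set" and m
    \<comment> \<open>The homogeneous function and the bump agree on the sphere, so
      \<open>conc\<close>, which requires homogeneity, yields information about bump
      integrals.\<close>
    have cong: "(\<integral>x. bump V m x * (\<integral>\<xi>. cone_bump U k \<xi> \<partial>\<kappa> x) \<partial>completion lam1) =
        (\<integral>x. bump V m x * (\<integral>\<xi>. bump U k \<xi> \<partial>\<kappa> x) \<partial>completion lam1)"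
      if "\<kappa> \<in> completion lam1 \<rightarrow>\<^sub>M prob_algebra (restrict_space borel (sphere 0 1))" for \<kappa>
      by (rule Bochner_Integration.integral_cong[OF refl], subst sph[OF that, of _ _ "bump U k"])
        (auto simp: cone_bump_sphere)
    show "(\<integral>x. bump V m x * (\<integral>\<xi>. bump U k \<xi> \<partial>\<kappa>1 x) \<partial>completion lam1) =
        (\<integral>x. bump V m x * (\<integral>\<xi>. bump U k \<xi> \<partial>\<kappa>2 x) \<partial>completion lam1)"
      unfolding cong[OF k1, symmetric] cong[OF k2', symmetric]
      using conc[of "bump V m" "cone_bump U k"] lam
      by (simp add: continuous_intros continuous_on_cone_bump cone_bump_homogeneous)
  qed
  then have "AE x in lam1. \<forall>U\<in>rational_boxes_set. \<forall>k. (\<integral>\<xi>. bump U k \<xi> \<partial>\<kappa>1 x) = (\<integral>\<xi>. bump U k \<xi> \<partial>\<kappa>2 x)"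
    by (intro AE_ball_countable'[OF _ countable_rational_boxes_set]) (simp add: AE_all_countable)
  then show "AE x in lam1. \<kappa>1 x = \<kappa>2 x"
    using AE_space
  proof eventually_elim
    case (elim x)
    have x: "x \<in> space (completion lam1)" using elim(2) by simp
    show ?case
      using prob_kernelD[OF k1 x] prob_kernelD[OF k2' x] elim(1)
      by (intro finite_measure_eqI_bump[where S="sphere 0 1"]) (auto simp: prob_space.finite_measure)
  qed
qed

theorem proposition2p23:
  fixes \<Omega> :: "'n::euclidean_space set"
    and \<mu> lam_nu lam_eta :: "'n measure"
    and a :: "'n \<Rightarrow> real"
    and A B :: "('d::euclidean_space \<Rightarrow> real) set"
    and v :: "nat \<Rightarrow> 'n \<Rightarrow> 'd"
    and \<nu> \<eta> :: "'n \<Rightarrow> 'd measure"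
    and \<nu>i \<eta>i :: "'n \<Rightarrow> (('d \<Rightarrow> real) \<Rightarrow> real) measure"
  assumes "open \<Omega>" and "bounded \<Omega>"
    and "finite_measure \<mu>" and "sets \<mu> = sets (restrict_space borel \<Omega>)"
    and "integrable \<mu> a" and "AE x in \<mu>. a x > 0"
    and "closed_separable_subalgebra A" and "C_cball \<subseteq> A"
    and "closed_separable_subalgebra B" and "C_cball \<subseteq> B"
    and "L1_bounded \<mu> v"
    and "young_conv_alg \<Omega> \<mu> A v \<nu> lam_nu \<nu>i"
    and "young_conv_alg \<Omega> (density \<mu> (\<lambda>x. ennreal (a x))) B (\<lambda>j x. v j x /\<^sub>R a x) \<eta> lam_eta \<eta>i"
  shows "(AE x in \<mu>. \<eta> x = distr (\<nu> x) borel (\<lambda>z. z /\<^sub>R a x)) \<and>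
    lam_nu = lam_eta \<and>
    (AE x in lam_nu. sphere_proj A (\<nu>i x) = sphere_proj B (\<eta>i x)) \<and>
    young_conv_sphere \<Omega> \<mu> v \<nu> lam_nu (\<lambda>x. sphere_proj A (\<nu>i x))"
proof -
  \<comment> \<open>The projected convergence \<open>y1\<close> is both an input to the comparison
    and the last assertion of the theorem.\<close>
  note y1 = young_conv_sphere_of_alg[OF assms(7,8,12)]
  note y2 = young_conv_sphere_of_alg[OF assms(9,10,13)]
  show ?thesis
    using young_conv_sphere_rescaled_unique[OF assms(3-6) y1 y2] y1 by blast
qed

end
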